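(* Let $n$ be an odd positive integer, let $d_1,\dots,d_n\ge 2$ be integers, let $g$ be a generator of the cyclic group $\mathbb{Z}_{d_1\cdots d_n+1}$, and let $\epsilon\in\mathbb{C}$ be a primitive root of unity of degree $d_1\cdots d_n+1$. Let $\tau$ be the action of $\mathbb{Z}_{d_1\cdots d_n+1}$ on $\mathbb{C}^n$ given by $$g\circ(x_1,\dots,x_n)=\bigl(\epsilon x_1,\ \epsilon^{-d_1}x_2,\ \dots,\ \epsilon^{(-1)^{n-2}d_1\cdots d_{n-2}}x_{n-1},\ \epsilon^{(-1)^{n-1}d_1\cdots d_{n-1}}x_n\bigr),$$ i.e. $x_i$ is multiplied by $\epsilon^{(-1)^{i-1}d_1\cdots d_{i-1}}$ for $1\le i\le n$. Then the polynomial $$f=x_1^{d_1}x_2+x_2^{d_2}x_3+\dots+x_{n-1}^{d_{n-1}}x_n+x_n^{d_n}x_1$$ is invariant with respect to $\tau$, it has an isolated critical point at the origin with Milnor number $\mu(f)=d_1\cdots d_n$, and every orbit of $\tau$ other than $\{0\}$ has length $d_1\cdots d_n+1$. Consequently $\mu(f)=l(\tau)-1$, so the bound $\mu\ge l(\tau)-1$ is attained in arbitrarily large dimension $n$.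
   Context: $\mu(f)=\dim_{\mathbb{C}} \mathbb{C}\{x_1,\dots,x_n\}/\langle \partial f/\partial x_1,\dots,\partial f/\partial x_n\rangle$ is the Milnor number of $f$ at the origin. $l(\tau)$ denotes the length (cardinality) of the shortest orbit of a point not fixed by the whole group. For $n=1$ the polynomial is understood as $x_1^{d_1}x_1=x_1^{d_1+1}$. *)

theory Defs
  imports
    "HOL-Analysis.Analysis"
    "HOL-Algebra.Algebra"
    "HOL-Library.Poly_Mapping"
    "HOL-Library.Extended_Nat"
begin

text \<open>
  Variables are numbered \<open>1, ..., n\<close>.  A monomial is a finitely supported exponent vector
  \<open>nat \<Rightarrow>\<^sub>0 nat\<close>, a polynomial is a finitely supported coefficient family
  \<open>(nat \<Rightarrow>\<^sub>0 nat) \<Rightarrow>\<^sub>0 complex\<close>, and a power series is an arbitrary coefficient family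
  \<open>(nat \<Rightarrow>\<^sub>0 nat) \<Rightarrow> complex\<close>; hence
  \<open>Poly_Mapping.lookup\<close> is the embedding of polynomials into power series.
\<close>

type_synonym monomial = "nat \<Rightarrow>\<^sub>0 nat"
type_synonym cpoly = "monomial \<Rightarrow>\<^sub>0 complex"
type_synonym series = "monomial \<Rightarrow> complex"

definition complex_space :: "nat \<Rightarrow> (nat \<Rightarrow> complex) set" where
  "complex_space n = {1..n} \<rightarrow>\<^sub>E UNIV"

definition origin :: "nat \<Rightarrow> nat \<Rightarrow> complex" where
  "origin n = (\<lambda>i\<in>{1..n}. 0)"

definition total_degree :: "monomial \<Rightarrow> nat" where
  "total_degree \<alpha> = (\<Sum>i\<in>Poly_Mapping.keys \<alpha>. Poly_Mapping.lookup \<alpha> i)"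

text \<open>The ring \<open>\<complex>{x\<^sub>1, ..., x\<^sub>n}\<close>: absolute convergence on some polydisc about the origin.\<close>

definition convergent_series :: "nat \<Rightarrow> series ring" where
  "convergent_series n =
    \<lparr>carrier = {a. (\<forall>\<alpha>. a \<alpha> \<noteq> 0 \<longrightarrow> Poly_Mapping.keys \<alpha> \<subseteq> {1..n}) \<and>
                   (\<exists>r>0. (\<lambda>\<alpha>. norm (a \<alpha>) * r ^ total_degree \<alpha>) summable_on UNIV)},
     Group.monoid.mult = (\<lambda>a b \<alpha>. \<Sum>(\<beta>, \<gamma>) \<in> {(\<beta>, \<gamma>). \<beta> + \<gamma> = \<alpha>}. a \<beta> * b \<gamma>),
     Group.monoid.one = (\<lambda>\<alpha>. if \<alpha> = 0 then 1 else 0),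
     Ring.ring.zero = (\<lambda>\<alpha>. 0),
     Ring.ring.add = (\<lambda>a b \<alpha>. a \<alpha> + b \<alpha>)\<rparr>"

definition const_series :: "complex \<Rightarrow> series" where
  "const_series c = (\<lambda>\<alpha>. if \<alpha> = 0 then c else 0)"

definition partial_series :: "nat \<Rightarrow> series \<Rightarrow> series" where
  "partial_series i a =
    (\<lambda>\<alpha>. of_nat (Poly_Mapping.lookup \<alpha> i + 1) * a (\<alpha> + Poly_Mapping.single i 1))"

definition jacobian_ideal :: "nat \<Rightarrow> series \<Rightarrow> series set" where
  "jacobian_ideal n f = Idl\<^bsub>convergent_series n\<^esub> ((\<lambda>i. partial_series i f) ` {1..n})"

definition milnor_algebra :: "nat \<Rightarrow> series \<Rightarrow> series set ring" where
  "milnor_algebra n f = convergent_series n Quot jacobian_ideal n f"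

text \<open>The scalars are the classes of the constant series; the value is \<open>\<infinity>\<close> when the
  quotient is not finite-dimensional.\<close>

definition milnor_scalars :: "nat \<Rightarrow> series \<Rightarrow> series set set" where
  "milnor_scalars n f =
    range (\<lambda>c. jacobian_ideal n f +>\<^bsub>convergent_series n\<^esub> const_series c)"

definition milnor_number :: "nat \<Rightarrow> series \<Rightarrow> enat" where
  "milnor_number n f =
    (if \<exists>k. ring.dimension (milnor_algebra n f) k (milnor_scalars n f) (carrier (milnor_algebra n f))
     then enat (THE k. ring.dimension (milnor_algebra n f) k (milnor_scalars n f)
                         (carrier (milnor_algebra n f)))
     else \<infinity>)"

definition var :: "nat \<Rightarrow> cpoly" where
  "var i = Poly_Mapping.single (Poly_Mapping.single i 1) 1"

definition poly_eval :: "cpoly \<Rightarrow> (nat \<Rightarrow> complex) \<Rightarrow> complex" where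
  "poly_eval f x = (\<Sum>\<alpha>\<in>Poly_Mapping.keys f. Poly_Mapping.lookup f \<alpha> *
      (\<Prod>i\<in>Poly_Mapping.keys \<alpha>. x i ^ Poly_Mapping.lookup \<alpha> i))"

definition critical_point :: "nat \<Rightarrow> cpoly \<Rightarrow> (nat \<Rightarrow> complex) \<Rightarrow> bool" where
  "critical_point n f x \<longleftrightarrow>
    x \<in> complex_space n \<and> (\<forall>i\<in>{1..n}. deriv (\<lambda>t. poly_eval f (x(i := t))) (x i) = 0)"

definition isolated_critical_origin :: "nat \<Rightarrow> cpoly \<Rightarrow> bool" where
  "isolated_critical_origin n f \<longleftrightarrow>
    critical_point n f (origin n) \<and>
    (\<exists>r>0. \<forall>x. critical_point n f x \<and> (\<forall>i\<in>{1..n}. norm (x i) < r) \<longrightarrow> x = origin n)"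

definition shortest_orbit_length ::
    "'g monoid \<Rightarrow> 'a set \<Rightarrow> ('g \<Rightarrow> 'a \<Rightarrow> 'a) \<Rightarrow> nat" where
  "shortest_orbit_length G E \<tau> =
    (LEAST k. \<exists>x\<in>E. (\<exists>h\<in>carrier G. \<tau> h x \<noteq> x) \<and> k = card (orbit G \<tau> x))"

definition invariant_polynomial ::
    "'g monoid \<Rightarrow> nat \<Rightarrow> ('g \<Rightarrow> (nat \<Rightarrow> complex) \<Rightarrow> nat \<Rightarrow> complex) \<Rightarrow> cpoly \<Rightarrow> bool" where
  "invariant_polynomial G n \<tau> f \<longleftrightarrow>
    (\<forall>h\<in>carrier G. \<forall>x\<in>complex_space n. poly_eval f (\<tau> h x) = poly_eval f x)"

definition primitive_root_of_unity :: "nat \<Rightarrow> complex \<Rightarrow> bool" where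
  "primitive_root_of_unity m \<epsilon> \<longleftrightarrow> \<epsilon> ^ m = 1 \<and> (\<forall>k. 0 < k \<and> k < m \<longrightarrow> \<epsilon> ^ k \<noteq> 1)"

definition loop_group :: "nat \<Rightarrow> (nat \<Rightarrow> nat) \<Rightarrow> int monoid" where
  "loop_group n d = integer_mod_group ((\<Prod>i\<in>{1..n}. d i) + 1)"

definition loop_poly :: "nat \<Rightarrow> (nat \<Rightarrow> nat) \<Rightarrow> cpoly" where
  "loop_poly n d = (\<Sum>i\<in>{1..n}. var i ^ d i * var (if i = n then 1 else i + 1))"

definition loop_action ::
    "nat \<Rightarrow> (nat \<Rightarrow> nat) \<Rightarrow> int \<Rightarrow> complex \<Rightarrow> (int \<Rightarrow> (nat \<Rightarrow> complex) \<Rightarrow> nat \<Rightarrow> complex) \<Rightarrow> bool"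
  where
  "loop_action n d g \<epsilon> \<tau> \<longleftrightarrow>
    group_action (loop_group n d) (complex_space n) \<tau> \<and>
    (\<forall>x\<in>complex_space n.
       \<tau> g x = (\<lambda>i\<in>{1..n}. \<epsilon> powi ((-1) ^ (i - 1) * (\<Prod>j\<in>{1..<i}. int (d j))) * x i))"

definition loop_data ::
    "nat \<Rightarrow> (nat \<Rightarrow> nat) \<Rightarrow> int \<Rightarrow> complex \<Rightarrow> bool" where
  "loop_data n d g \<epsilon> \<longleftrightarrow>
    odd n \<and> (\<forall>i\<in>{1..n}. 2 \<le> d i) \<and>
    g \<in> carrier (loop_group n d) \<and> generate (loop_group n d) {g} = carrier (loop_group n d) \<and>
    primitive_root_of_unity ((\<Prod>i\<in>{1..n}. d i) + 1) \<epsilon>"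

end

theory Submission
  imports Defs
begin

text \<open>
  Up to scalars the partial derivatives of the loop polynomial are binomials, so modulo the
  Jacobian ideal \<open>x\<^sub>i\<^bsup>d\<^sub>i\<^esup>\<close> reduces to
  \<open>-d\<^sub>i\<^sub>+\<^sub>1\<close> times the monomial
  \<open>x\<^sub>i\<^sub>+\<^sub>1\<^bsup>d\<^sub>i\<^sub>+\<^sub>1 - 1\<^esup> x\<^sub>i\<^sub>+\<^sub>2\<close>
  (indices cyclic).  Each reduction multiplies by a scalar of modulus at least 2, so a monomial
  whose chain of reductions runs into a cycle lies in the ideal.  In particular the ideal contains
  \<open>x\<^sub>i\<^bsup>2d\<^sub>i\<^esup>\<close>, which leaves finitely many monomials, and
  each of them lies in the ideal or reduces to a multiple of a monomial in the box
  \<open>0 \<le> a\<^sub>i < d\<^sub>i\<close>; the box therefore spans the Milnor algebra.  For its independence, a finitely supported functional that annihilates the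
  ideal and equals 1 on the socle \<open>\<Prod>\<^sub>i x\<^sub>i\<^bsup>d\<^sub>i - 1\<^esup>\<close>
  is written down explicitly.  For odd \<open>n\<close> the pairing it induces makes the monomials of
  the box dual to their complements in the socle.

  Every coordinate of the generator of the action is itself a primitive root of unity of degree
  \<open>d\<^sub>1 \<cdots> d\<^sub>n + 1\<close>, because its exponent divides
  \<open>d\<^sub>1 \<cdots> d\<^sub>n\<close> up to sign; hence all nonzero orbits are as long as
  the group.
\<close>

subsection \<open>Monomials\<close>

text \<open>Exponents off \<open>A\<close> are 0, so a monomial supported on \<open>A\<close> is
  determined by its restriction. Through \<open>PiE\<close> this yields both the finiteness and the
  cardinality of exponent boxes.\<close>

lemma monomial_exponents_bij:
  assumes "finite A"
  shows "bij_betw (\<lambda>\<alpha>::monomial. restrict (Poly_Mapping.lookup \<alpha>) A)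
           {\<alpha>. Poly_Mapping.keys \<alpha> \<subseteq> A \<and> (\<forall>i\<in>A. Poly_Mapping.lookup \<alpha> i \<in> B i)} (PiE A B)"
proof (rule bij_betw_imageI)
  show "inj_on (\<lambda>\<alpha>::monomial. restrict (Poly_Mapping.lookup \<alpha>) A)
          {\<alpha>. Poly_Mapping.keys \<alpha> \<subseteq> A \<and> (\<forall>i\<in>A. Poly_Mapping.lookup \<alpha> i \<in> B i)}"
  proof (rule inj_onI, rule poly_mapping_eqI)
    fix \<alpha> \<beta> :: monomial and i
    assume \<alpha>: "\<alpha> \<in> {\<alpha>. Poly_Mapping.keys \<alpha> \<subseteq> A \<and> (\<forall>i\<in>A. Poly_Mapping.lookup \<alpha> i \<in> B i)}"
      and \<beta>: "\<beta> \<in> {\<alpha>. Poly_Mapping.keys \<alpha> \<subseteq> A \<and> (\<forall>i\<in>A. Poly_Mapping.lookup \<alpha> i \<in> B i)}"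
      and eq: "restrict (Poly_Mapping.lookup \<alpha>) A = restrict (Poly_Mapping.lookup \<beta>) A"
    show "Poly_Mapping.lookup \<alpha> i = Poly_Mapping.lookup \<beta> i"
    proof (cases "i \<in> A")
      case True
      then show ?thesis using fun_cong[OF eq, of i] by simp
    next
      case False
      with \<alpha> \<beta> have "i \<notin> Poly_Mapping.keys \<alpha>" "i \<notin> Poly_Mapping.keys \<beta>" by auto
      then show ?thesis by (simp add: in_keys_iff)
    qed
  qed
next
  show "(\<lambda>\<alpha>::monomial. restrict (Poly_Mapping.lookup \<alpha>) A) `
      {\<alpha>. Poly_Mapping.keys \<alpha> \<subseteq> A \<and> (\<forall>i\<in>A. Poly_Mapping.lookup \<alpha> i \<in> B i)} = PiE A B"
  proof (intro equalityI subsetI)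
    fix f assume f: "f \<in> PiE A B"
    define \<alpha> :: monomial where "\<alpha> = (\<Sum>i\<in>A. Poly_Mapping.single i (f i))"
    have l: "Poly_Mapping.lookup \<alpha> i = (if i \<in> A then f i else 0)" for i
      using assms by (simp add: \<alpha>_def lookup_sum lookup_single when_def)
    have "restrict (Poly_Mapping.lookup \<alpha>) A = f"
      using f by (auto simp: fun_eq_iff l PiE_def extensional_def)
    moreover have "Poly_Mapping.keys \<alpha> \<subseteq> A" by (auto simp: in_keys_iff l split: if_splits)
    moreover have "\<forall>i\<in>A. Poly_Mapping.lookup \<alpha> i \<in> B i" using f by (auto simp: l)
    ultimately show "f \<in> (\<lambda>\<alpha>::monomial. restrict (Poly_Mapping.lookup \<alpha>) A) `
      {\<alpha>. Poly_Mapping.keys \<alpha> \<subseteq> A \<and> (\<forall>i\<in>A. Poly_Mapping.lookup \<alpha> i \<in> B i)}" by blast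
  qed auto
qed

lemma finite_bounded_monomials:
  assumes "finite A"
  shows "finite {\<alpha>::monomial. Poly_Mapping.keys \<alpha> \<subseteq> A \<and> (\<forall>i\<in>A. Poly_Mapping.lookup \<alpha> i < u i)}"
proof -
  have "finite (PiE A (\<lambda>i. {..<u i}))" using assms by (simp add: finite_PiE)
  then have "finite {\<alpha>::monomial. Poly_Mapping.keys \<alpha> \<subseteq> A \<and> (\<forall>i\<in>A. Poly_Mapping.lookup \<alpha> i \<in> {..<u i})}"
    by (rule bij_betw_finite[OF monomial_exponents_bij[OF assms], THEN iffD2])
  then show ?thesis by simp
qed

lemma card_bounded_monomials:
  assumes "finite A"
  shows "card {\<alpha>::monomial. Poly_Mapping.keys \<alpha> \<subseteq> A \<and> (\<forall>i\<in>A. Poly_Mapping.lookup \<alpha> i < u i)} =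
           (\<Prod>i\<in>A. u i)"
  using bij_betw_same_card[OF monomial_exponents_bij[OF assms, of "\<lambda>i. {..<u i}"]] assms
  by (simp add: card_PiE)

lemma keys_add_monomial:
  "Poly_Mapping.keys (\<alpha> + \<beta> :: monomial) = Poly_Mapping.keys \<alpha> \<union> Poly_Mapping.keys \<beta>"
  by (auto simp: in_keys_iff lookup_add)

lemma split_power:
  fixes \<alpha> :: monomial
  assumes "k \<le> Poly_Mapping.lookup \<alpha> i"
  shows "\<alpha> = (\<alpha> - Poly_Mapping.single i k) + Poly_Mapping.single i k"
  using assms by (intro poly_mapping_eqI) (auto simp: lookup_add lookup_minus lookup_single when_def)

lemma keys_diff_monomial: "Poly_Mapping.keys (\<alpha> - \<beta> :: monomial) \<subseteq> Poly_Mapping.keys \<alpha>"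
  by (auto simp: in_keys_iff lookup_minus)

text \<open>The factors of a monomial have exponents bounded by its own, and the first factor
  determines the second. Hence every coefficient of a Cauchy product is a finite sum.\<close>

lemma finite_splits: "finite {(\<beta>, \<gamma>). \<beta> + \<gamma> = (\<alpha>::monomial)}"
proof -
  let ?D = "{\<beta>::monomial. Poly_Mapping.keys \<beta> \<subseteq> Poly_Mapping.keys \<alpha> \<and>
              (\<forall>i\<in>Poly_Mapping.keys \<alpha>. Poly_Mapping.lookup \<beta> i < Suc (Poly_Mapping.lookup \<alpha> i))}"
  have "{(\<beta>, \<gamma>). \<beta> + \<gamma> = \<alpha>} \<subseteq> (\<lambda>\<beta>. (\<beta>, \<alpha> - \<beta>)) ` ?D"
    by (auto simp: keys_add_monomial lookup_add less_Suc_eq_le intro!: image_eqI)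
  then show ?thesis
    by (rule finite_subset) (intro finite_imageI finite_bounded_monomials finite_keys)
qed

lemma total_degree_superset:
  assumes "finite A" "Poly_Mapping.keys \<alpha> \<subseteq> A"
  shows "total_degree \<alpha> = (\<Sum>i\<in>A. Poly_Mapping.lookup \<alpha> i)"
  unfolding total_degree_def using assms by (intro sum.mono_neutral_left) (auto simp: in_keys_iff)

lemma total_degree_add: "total_degree (\<alpha> + \<beta>) = total_degree \<alpha> + total_degree \<beta>"
proof -
  let ?A = "Poly_Mapping.keys \<alpha> \<union> Poly_Mapping.keys \<beta>"
  have "total_degree (\<alpha> + \<beta>) = (\<Sum>i\<in>?A. Poly_Mapping.lookup (\<alpha> + \<beta>) i)"
    by (rule total_degree_superset) (auto simp: keys_add_monomial)
  also have "\<dots> = total_degree \<alpha> + total_degree \<beta>"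
    by (simp add: lookup_add sum.distrib total_degree_superset[of ?A])
  finally show ?thesis .
qed

subsection \<open>The ring of convergent power series\<close>

text \<open>The multiplication of \<open>convergent_series n\<close>, which is the same for all
  \<open>n\<close>; its algebraic laws hold for arbitrary formal series.\<close>

definition series_mult :: "series \<Rightarrow> series \<Rightarrow> series" where
  "series_mult a b = (\<lambda>\<alpha>. \<Sum>(\<beta>, \<gamma>) \<in> {(\<beta>, \<gamma>). \<beta> + \<gamma> = \<alpha>}. a \<beta> * b \<gamma>)"

lemma series_mult_commute: "series_mult a b = series_mult b a"
  unfolding series_mult_def
  by (rule ext, rule sum.reindex_bij_witness[of _ prod.swap prod.swap]) (auto simp: add.commute)

lemma series_mult_assoc: "series_mult (series_mult a b) c = series_mult a (series_mult b c)"
proof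
  fix \<alpha> :: monomial
  let ?S = "\<lambda>\<alpha>::monomial. {(\<beta>, \<gamma>). \<beta> + \<gamma> = \<alpha>}"
  have "series_mult (series_mult a b) c \<alpha> =
          (\<Sum>p\<in>?S \<alpha>. \<Sum>q\<in>?S (fst p). a (fst q) * b (snd q) * c (snd p))"
    by (simp add: series_mult_def sum_distrib_right case_prod_unfold)
  also have "\<dots> = (\<Sum>(p, q)\<in>Sigma (?S \<alpha>) (\<lambda>p. ?S (fst p)). a (fst q) * b (snd q) * c (snd p))"
    by (rule sum.Sigma) (auto intro: finite_splits)
  \<comment> \<open>Both sums run over the triples with sum \<alpha>; the bracketing
    \<open>((u, v), w)\<close> is exchanged for \<open>(u, (v, w))\<close>.\<close>
  also have "\<dots> = (\<Sum>(p, q)\<in>Sigma (?S \<alpha>) (\<lambda>p. ?S (snd p)). a (fst p) * b (fst q) * c (snd q))"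
    by (rule sum.reindex_bij_witness[of _
          "\<lambda>(p, q). ((fst p + fst q, snd q), (fst p, fst q))"
          "\<lambda>(p, q). ((fst q, snd q + snd p), (snd q, snd p))"])
       (auto simp: add.assoc)
  also have "\<dots> = (\<Sum>p\<in>?S \<alpha>. \<Sum>q\<in>?S (snd p). a (fst p) * b (fst q) * c (snd q))"
    by (rule sum.Sigma[symmetric]) (auto intro: finite_splits)
  also have "\<dots> = series_mult a (series_mult b c) \<alpha>"
    by (simp add: series_mult_def sum_distrib_left case_prod_unfold mult.assoc)
  finally show "series_mult (series_mult a b) c \<alpha> = series_mult a (series_mult b c) \<alpha>" .
qed

lemma series_mult_add_left:
  "series_mult (\<lambda>\<alpha>. a \<alpha> + b \<alpha>) c = (\<lambda>\<alpha>. series_mult a c \<alpha> + series_mult b c \<alpha>)"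
  by (simp add: series_mult_def distrib_right sum.distrib case_prod_unfold)

definition monom_series :: "complex \<Rightarrow> monomial \<Rightarrow> series" where
  "monom_series c \<beta> = (\<lambda>\<alpha>. if \<alpha> = \<beta> then c else 0)"

lemma const_series_eq: "const_series c = monom_series c 0"
  by (simp add: const_series_def monom_series_def fun_eq_iff)

text \<open>Only the split with first factor \<beta> contributes. The divisibility test is there
  because subtraction of exponents truncates at 0.\<close>

lemma series_mult_monom:
  "series_mult (monom_series c \<beta>) a \<alpha> = (if \<exists>\<gamma>. \<beta> + \<gamma> = \<alpha> then c * a (\<alpha> - \<beta>) else 0)"
proof -
  have "series_mult (monom_series c \<beta>) a \<alpha> =
     (\<Sum>p\<in>{(\<beta>, \<gamma>). \<beta> + \<gamma> = \<alpha>}. if fst p = \<beta> then c * a (snd p) else 0)"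
    by (auto simp: series_mult_def monom_series_def case_prod_unfold intro!: sum.cong)
  also have "\<dots> = (\<Sum>p\<in>{p \<in> {(\<beta>, \<gamma>). \<beta> + \<gamma> = \<alpha>}. fst p = \<beta>}. c * a (snd p))"
    by (rule sum.inter_filter[symmetric]) (rule finite_splits)
  also have "\<dots> = (if \<exists>\<gamma>. \<beta> + \<gamma> = \<alpha> then c * a (\<alpha> - \<beta>) else 0)"
  proof (cases "\<exists>\<gamma>. \<beta> + \<gamma> = \<alpha>")
    case True
    then have "{p \<in> {(\<beta>, \<gamma>). \<beta> + \<gamma> = \<alpha>}. fst p = \<beta>} = {(\<beta>, \<alpha> - \<beta>)}" by auto
    with True show ?thesis by simp
  next
    case False
    then have "{p \<in> {(\<beta>, \<gamma>). \<beta> + \<gamma> = \<alpha>}. fst p = \<beta>} = {}" by auto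
    then show ?thesis using False by (simp only: sum.empty if_False)
  qed
  finally show ?thesis .
qed

lemma series_mult_monom_add: "series_mult (monom_series c \<beta>) a (\<beta> + \<gamma>) = c * a \<gamma>"
  by (auto simp: series_mult_monom)

lemma series_mult_const: "series_mult (const_series c) a = (\<lambda>\<alpha>. c * a \<alpha>)"
  using series_mult_monom_add[of c 0 a] by (simp add: const_series_eq fun_eq_iff)

lemma series_mult_monom_monom:
  "series_mult (monom_series c \<beta>) (monom_series e \<gamma>) = monom_series (c * e) (\<beta> + \<gamma>)"
  by (rule ext, simp only: series_mult_monom) (auto simp: monom_series_def)

text \<open>The convergence clause of the carrier with its radius exposed, so that two series can be
  brought to a common radius.\<close>

definition converges_at :: "real \<Rightarrow> series \<Rightarrow> bool" where
  "converges_at r a \<longleftrightarrow> (\<lambda>\<alpha>. norm (a \<alpha>) * r ^ total_degree \<alpha>) summable_on UNIV"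

lemma converges_at_mono:
  assumes "converges_at r a" "0 \<le> s" "s \<le> r"
  shows "converges_at s a"
  unfolding converges_at_def
proof (rule summable_on_comparison_test)
  show "(\<lambda>\<alpha>. norm (a \<alpha>) * r ^ total_degree \<alpha>) summable_on UNIV"
    using assms(1) by (simp add: converges_at_def)
qed (use assms in \<open>auto intro!: mult_left_mono power_mono\<close>)

lemma converges_at_add:
  assumes "converges_at r a" "converges_at r b" "0 \<le> r"
  shows "converges_at r (\<lambda>\<alpha>. a \<alpha> + b \<alpha>)"
  unfolding converges_at_def
proof (rule summable_on_comparison_test)
  show "(\<lambda>\<alpha>. norm (a \<alpha>) * r ^ total_degree \<alpha> + norm (b \<alpha>) * r ^ total_degree \<alpha>) summable_on UNIV"
    using assms by (intro summable_on_add) (simp_all add: converges_at_def)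
  show "norm (a \<alpha> + b \<alpha>) * r ^ total_degree \<alpha> \<le>
      norm (a \<alpha>) * r ^ total_degree \<alpha> + norm (b \<alpha>) * r ^ total_degree \<alpha>" for \<alpha>
    using assms(3) by (simp flip: distrib_right add: mult_right_mono norm_triangle_ineq)
qed (use assms in auto)

text \<open>A partial sum of the product is dominated by a product of partial sums of the factors,
  hence by the product of the two full sums; bounded nonnegative partial sums give
  summability.\<close>

lemma converges_at_mult:
  assumes a: "converges_at r a" and b: "converges_at r b" and r: "0 \<le> r"
  shows "converges_at r (series_mult a b)"
proof -
  let ?S = "\<lambda>\<alpha>::monomial. {(\<beta>, \<gamma>). \<beta> + \<gamma> = \<alpha>}"
  define A where "A = (\<lambda>\<alpha>. norm (a \<alpha>) * r ^ total_degree \<alpha>)"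
  define B where "B = (\<lambda>\<alpha>. norm (b \<alpha>) * r ^ total_degree \<alpha>)"
  have A0: "A \<alpha> \<ge> 0" and B0: "B \<alpha> \<ge> 0" for \<alpha> using r by (auto simp: A_def B_def)
  have sA: "A summable_on UNIV" and sB: "B summable_on UNIV"
    using a b by (simp_all add: converges_at_def A_def B_def)
  have bound: "norm (series_mult a b \<alpha>) * r ^ total_degree \<alpha> \<le> (\<Sum>p\<in>?S \<alpha>. A (fst p) * B (snd p))" for \<alpha>
  proof -
    have "norm (series_mult a b \<alpha>) \<le> (\<Sum>p\<in>?S \<alpha>. norm (a (fst p)) * norm (b (snd p)))"
      unfolding series_mult_def by (rule order_trans[OF norm_sum]) (simp add: norm_mult case_prod_unfold)
    then have "norm (series_mult a b \<alpha>) * r ^ total_degree \<alpha> \<le>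
        (\<Sum>p\<in>?S \<alpha>. norm (a (fst p)) * norm (b (snd p))) * r ^ total_degree \<alpha>"
      using r by (simp add: mult_right_mono)
    also have "\<dots> = (\<Sum>p\<in>?S \<alpha>. A (fst p) * B (snd p))"
      unfolding sum_distrib_right
      by (rule sum.cong) (auto simp: A_def B_def total_degree_add power_add)
    finally show ?thesis .
  qed
  show ?thesis
    unfolding converges_at_def
  proof (rule nonneg_bdd_above_summable_on)
    show "bdd_above (sum (\<lambda>\<alpha>. norm (series_mult a b \<alpha>) * r ^ total_degree \<alpha>) ` {F. F \<subseteq> UNIV \<and> finite F})"
    proof (rule bdd_aboveI2)
      fix F :: "monomial set" assume "F \<in> {F. F \<subseteq> UNIV \<and> finite F}"
      then have F: "finite F" by simp
      \<comment> \<open>All splits of the monomials of \<open>F\<close> at once. They lie in the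
        rectangle of their first and second components, over which the sum factors.\<close>
      define P where "P = (\<Union>\<alpha>\<in>F. ?S \<alpha>)"
      have P: "finite P" unfolding P_def using F finite_splits by blast
      have "(\<Sum>\<alpha>\<in>F. norm (series_mult a b \<alpha>) * r ^ total_degree \<alpha>) \<le>
             (\<Sum>\<alpha>\<in>F. \<Sum>p\<in>?S \<alpha>. A (fst p) * B (snd p))"
        by (rule sum_mono) (rule bound)
      also have "\<dots> = (\<Sum>p\<in>P. A (fst p) * B (snd p))"
        unfolding P_def by (rule sum.UNION_disjoint[symmetric]) (use F finite_splits in auto)
      also have "\<dots> \<le> (\<Sum>p\<in>fst ` P \<times> snd ` P. A (fst p) * B (snd p))"
        by (rule sum_mono2) (use P A0 B0 in \<open>auto intro: rev_image_eqI\<close>)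
      also have "\<dots> = (\<Sum>\<beta>\<in>fst ` P. A \<beta>) * (\<Sum>\<gamma>\<in>snd ` P. B \<gamma>)"
        by (simp add: sum_product sum.cartesian_product case_prod_unfold)
      also have "\<dots> \<le> infsum A UNIV * infsum B UNIV"
        by (intro mult_mono finite_sum_le_infsum sum_nonneg infsum_nonneg sA sB) (use P A0 B0 in auto)
      finally show "(\<Sum>\<alpha>\<in>F. norm (series_mult a b \<alpha>) * r ^ total_degree \<alpha>)
          \<le> infsum A UNIV * infsum B UNIV" .
    qed
  qed (use r in auto)
qed

lemma converges_at_finite:
  assumes "finite {\<alpha>. a \<alpha> \<noteq> 0}"
  shows "converges_at r a"
  unfolding converges_at_def
  by (rule summable_on_cong_neutral[THEN iffD1, OF _ _ _ summable_on_finite[OF assms]]) auto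

lemma carrier_convergent_series:
  "a \<in> carrier (convergent_series n) \<longleftrightarrow>
     (\<forall>\<alpha>. a \<alpha> \<noteq> 0 \<longrightarrow> Poly_Mapping.keys \<alpha> \<subseteq> {1..n}) \<and> (\<exists>r>0. converges_at r a)"
  by (simp add: convergent_series_def converges_at_def)

lemma convergent_series_simps [simp]:
  "a \<otimes>\<^bsub>convergent_series n\<^esub> b = series_mult a b"
  "\<one>\<^bsub>convergent_series n\<^esub> = const_series 1"
  "\<zero>\<^bsub>convergent_series n\<^esub> = (\<lambda>\<alpha>. 0)"
  "a \<oplus>\<^bsub>convergent_series n\<^esub> b = (\<lambda>\<alpha>. a \<alpha> + b \<alpha>)"
  by (simp_all add: convergent_series_def series_mult_def const_series_def fun_eq_iff)

lemma finite_series_carrier: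
  assumes "finite {\<alpha>. a \<alpha> \<noteq> 0}" "\<And>\<alpha>. a \<alpha> \<noteq> 0 \<Longrightarrow> Poly_Mapping.keys \<alpha> \<subseteq> {1..n}"
  shows "a \<in> carrier (convergent_series n)"
  using assms converges_at_finite[OF assms(1), of 1]
  by (auto simp: carrier_convergent_series intro: exI[of _ 1])

lemma monom_series_carrier:
  "Poly_Mapping.keys \<beta> \<subseteq> {1..n} \<Longrightarrow> monom_series c \<beta> \<in> carrier (convergent_series n)"
  by (rule finite_series_carrier) (auto simp: monom_series_def split: if_splits)

lemma const_series_carrier: "const_series c \<in> carrier (convergent_series n)"
  by (simp add: const_series_eq monom_series_carrier)

lemma common_convergence:
  assumes "a \<in> carrier (convergent_series n)" "b \<in> carrier (convergent_series n)"
  obtains r where "r > 0" "converges_at r a" "converges_at r b"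
proof -
  from assms obtain r s where "r > 0" "converges_at r a" "s > 0" "converges_at s b"
    by (auto simp: carrier_convergent_series)
  then show thesis
    by (intro that[of "min r s"]) (auto intro: converges_at_mono)
qed

lemma series_mult_carrier:
  assumes "a \<in> carrier (convergent_series n)" "b \<in> carrier (convergent_series n)"
  shows "series_mult a b \<in> carrier (convergent_series n)"
proof -
  obtain r where r: "r > 0" "converges_at r a" "converges_at r b"
    using common_convergence[OF assms] .
  have "Poly_Mapping.keys \<alpha> \<subseteq> {1..n}" if nz: "series_mult a b \<alpha> \<noteq> 0" for \<alpha>
  proof -
    obtain p where "p \<in> {(\<beta>, \<gamma>). \<beta> + \<gamma> = \<alpha>}" "(case p of (\<beta>, \<gamma>) \<Rightarrow> a \<beta> * b \<gamma>) \<noteq> 0"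
      using sum.not_neutral_contains_not_neutral[OF nz[unfolded series_mult_def]] by blast
    with assms show ?thesis
      by (cases p) (auto simp: carrier_convergent_series keys_add_monomial subset_iff)
  qed
  moreover have "converges_at r (series_mult a b)"
    using converges_at_mult[OF r(2,3)] r(1) by simp
  ultimately show ?thesis using r(1) by (auto simp: carrier_convergent_series)
qed

lemma series_add_carrier:
  assumes "a \<in> carrier (convergent_series n)" "b \<in> carrier (convergent_series n)"
  shows "(\<lambda>\<alpha>. a \<alpha> + b \<alpha>) \<in> carrier (convergent_series n)"
proof -
  obtain r where r: "r > 0" "converges_at r a" "converges_at r b"
    using common_convergence[OF assms] .
  have "Poly_Mapping.keys \<alpha> \<subseteq> {1..n}" if "a \<alpha> + b \<alpha> \<noteq> 0" for \<alpha>
  proof -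
    have "a \<alpha> \<noteq> 0 \<or> b \<alpha> \<noteq> 0" using that by auto
    with assms show ?thesis by (auto simp: carrier_convergent_series)
  qed
  moreover have "converges_at r (\<lambda>\<alpha>. a \<alpha> + b \<alpha>)"
    using converges_at_add[OF r(2,3)] r(1) by simp
  ultimately show ?thesis using r(1) by (auto simp: carrier_convergent_series)
qed

lemma series_scale_carrier:
  assumes "a \<in> carrier (convergent_series n)"
  shows "(\<lambda>\<alpha>. c * a \<alpha>) \<in> carrier (convergent_series n)"
  using series_mult_carrier[OF const_series_carrier[of c] assms] by (simp add: series_mult_const)

lemma cring_convergent_series: "cring (convergent_series n)"
proof (rule cringI)
  have zero: "(\<lambda>\<alpha>. 0) \<in> carrier (convergent_series n)"
    by (rule finite_series_carrier) auto
  show "abelian_group (convergent_series n)"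
  proof (rule abelian_groupI)
    fix a assume a: "a \<in> carrier (convergent_series n)"
    show "\<exists>b\<in>carrier (convergent_series n).
        b \<oplus>\<^bsub>convergent_series n\<^esub> a = \<zero>\<^bsub>convergent_series n\<^esub>"
      using series_scale_carrier[OF a, of "-1"] by (intro bexI[of _ "\<lambda>\<alpha>. -1 * a \<alpha>"]) auto
  qed (auto simp: series_add_carrier zero add.assoc add.commute)
  show "comm_monoid (convergent_series n)"
    by (rule comm_monoidI)
       (auto simp: series_mult_carrier const_series_carrier series_mult_assoc series_mult_const
             intro: series_mult_commute)
qed (simp add: series_mult_add_left)

lemma convergent_series_minus:
  assumes "a \<in> carrier (convergent_series n)" "b \<in> carrier (convergent_series n)"
  shows "a \<ominus>\<^bsub>convergent_series n\<^esub> b = (\<lambda>\<alpha>. a \<alpha> - b \<alpha>)"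
proof -
  interpret cring "convergent_series n" by (rule cring_convergent_series)
  have "\<ominus>\<^bsub>convergent_series n\<^esub> b = (\<lambda>\<alpha>. -1 * b \<alpha>)"
    by (rule minus_equality) (use assms series_scale_carrier[OF assms(2), of "-1"] in auto)
  then show ?thesis by (simp add: a_minus_def)
qed

text \<open>Dropping terms keeps absolute convergence, so a series may be cut along any condition on
  monomials.\<close>

lemma series_restrict_carrier:
  assumes "a \<in> carrier (convergent_series n)"
  shows "(\<lambda>\<alpha>. if P \<alpha> then a \<alpha> else 0) \<in> carrier (convergent_series n)"
proof -
  obtain r where r: "r > 0" "converges_at r a" using assms by (auto simp: carrier_convergent_series)
  have "converges_at r (\<lambda>\<alpha>. if P \<alpha> then a \<alpha> else 0)"
    unfolding converges_at_def
    by (rule summable_on_comparison_test[OF r(2)[unfolded converges_at_def]]) (use r(1) in auto)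
  with assms r(1) show ?thesis by (auto simp: carrier_convergent_series)
qed

text \<open>The cofactor is the series of shifted coefficients. It converges at the same radius
  because the shift changes every summand by the fixed factor \<open>r ^ k\<close>.\<close>

lemma series_factor_monom:
  assumes h: "h \<in> carrier (convergent_series n)"
    and div: "\<And>\<alpha>. h \<alpha> \<noteq> 0 \<Longrightarrow> k \<le> Poly_Mapping.lookup \<alpha> i"
  obtains g where "g \<in> carrier (convergent_series n)"
    "h = series_mult (monom_series 1 (Poly_Mapping.single i k)) g"
proof -
  let ?e = "Poly_Mapping.single i k :: monomial"
  define g where "g = (\<lambda>\<gamma>. h (?e + \<gamma>))"
  obtain r where r: "r > 0" "converges_at r h" using h by (auto simp: carrier_convergent_series)
  have "((\<lambda>\<alpha>. norm (h \<alpha>) * r ^ total_degree \<alpha>) \<circ> (+) ?e) summable_on UNIV"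
    by (subst summable_on_reindex[symmetric])
       (auto intro: summable_on_subset_banach[OF r(2)[unfolded converges_at_def]])
  then have "(\<lambda>\<gamma>. inverse (r ^ total_degree ?e) *
       ((\<lambda>\<alpha>. norm (h \<alpha>) * r ^ total_degree \<alpha>) \<circ> (+) ?e) \<gamma>) summable_on UNIV"
    by (rule summable_on_cmult_right)
  moreover have "(\<lambda>\<gamma>. inverse (r ^ total_degree ?e) *
       ((\<lambda>\<alpha>. norm (h \<alpha>) * r ^ total_degree \<alpha>) \<circ> (+) ?e) \<gamma>) = (\<lambda>\<gamma>. norm (g \<gamma>) * r ^ total_degree \<gamma>)"
    using r(1) by (auto simp: g_def total_degree_add power_add fun_eq_iff)
  ultimately have "converges_at r g" by (simp add: converges_at_def)
  moreover have "Poly_Mapping.keys \<gamma> \<subseteq> {1..n}" if "g \<gamma> \<noteq> 0" for \<gamma>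
  proof -
    have "Poly_Mapping.keys (?e + \<gamma>) \<subseteq> {1..n}"
      using h that unfolding g_def carrier_convergent_series by blast
    then show ?thesis by (simp add: keys_add_monomial)
  qed
  ultimately have "g \<in> carrier (convergent_series n)" using r(1) by (auto simp: carrier_convergent_series)
  moreover have "h = series_mult (monom_series 1 ?e) g"
  proof
    fix \<alpha>
    show "h \<alpha> = series_mult (monom_series 1 ?e) g \<alpha>"
    proof (cases "\<exists>\<gamma>. ?e + \<gamma> = \<alpha>")
      case True
      then show ?thesis by (auto simp: series_mult_monom_add g_def)
    next
      case False
      have "h \<alpha> = 0"
      proof (rule ccontr)
        assume "h \<alpha> \<noteq> 0"
        then have "?e + (\<alpha> - ?e) = \<alpha>"
          using div by (intro poly_mapping_eqI) (auto simp: lookup_add lookup_minus lookup_single when_def)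
        with False show False by blast
      qed
      with False show ?thesis by (simp add: series_mult_monom)
    qed
  qed
  ultimately show thesis by (rule that)
qed

section \<open>Ideals of convergent power series and congruence of monomials\<close>

locale series_ideal =
  fixes n :: nat and J :: "series set"
  assumes ideal: "ideal J (convergent_series n)"
begin

lemma carrierI: "h \<in> J \<Longrightarrow> h \<in> carrier (convergent_series n)"
  using ideal.Icarr[OF ideal] .

lemma add: "g \<in> J \<Longrightarrow> h \<in> J \<Longrightarrow> (\<lambda>\<alpha>. g \<alpha> + h \<alpha>) \<in> J"
  using additive_subgroup.a_closed[OF ideal.axioms(1)[OF ideal], of g h] by simp

lemma zero: "(\<lambda>\<alpha>. 0) \<in> J"
  using additive_subgroup.zero_closed[OF ideal.axioms(1)[OF ideal]] by simp

lemma mult: "g \<in> carrier (convergent_series n) \<Longrightarrow> h \<in> J \<Longrightarrow> series_mult g h \<in> J"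
  using ideal.I_l_closed[OF ideal, of h g] by simp

lemma scale: "h \<in> J \<Longrightarrow> (\<lambda>\<alpha>. c * h \<alpha>) \<in> J"
  using mult[OF const_series_carrier, of h c] by (simp add: series_mult_const)

lemma scale_cancel:
  assumes "(\<lambda>\<alpha>. c * h \<alpha>) \<in> J" "c \<noteq> 0"
  shows "h \<in> J"
  using scale[OF assms(1), of "inverse c"] assms(2) by (simp add: mult.assoc[symmetric])

text \<open>A sequence of scalings by factors of modulus greater than 1 inside a finite set of
  monomials runs into a cycle, along which a monomial is congruent to a multiple of itself by a
  factor different from 1.\<close>

lemma expanding_monomials_mem:
  assumes fin: "finite Z"
    and step: "\<And>\<alpha>. \<alpha> \<in> Z \<Longrightarrow> \<exists>\<beta>\<in>Z. \<exists>s. norm s > 1 \<and>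
                 (\<lambda>\<delta>. monom_series 1 \<alpha> \<delta> - s * monom_series 1 \<beta> \<delta>) \<in> J"
    and \<alpha>: "\<alpha> \<in> Z"
  shows "monom_series 1 \<alpha> \<in> J"
proof -
  have "\<forall>\<alpha>. \<exists>\<beta> s. \<alpha> \<in> Z \<longrightarrow> \<beta> \<in> Z \<and> norm s > 1 \<and>
          (\<lambda>\<delta>. monom_series 1 \<alpha> \<delta> - s * monom_series 1 \<beta> \<delta>) \<in> J"
    using step by blast
  then obtain nx s where nx: "\<And>\<alpha>. \<alpha> \<in> Z \<Longrightarrow> nx \<alpha> \<in> Z \<and> norm (s \<alpha> :: complex) > 1 \<and>
          (\<lambda>\<delta>. monom_series 1 \<alpha> \<delta> - s \<alpha> * monom_series 1 (nx \<alpha>) \<delta>) \<in> J"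
    by metis
  define q where "q k = (nx ^^ k) \<alpha>" for k
  have qZ: "q k \<in> Z" for k by (induction k) (auto simp: q_def \<alpha> nx)
  \<comment> \<open>The bound is strict only for \<open>k > 0\<close>, since the empty chain has
    factor 1.\<close>
  have chain: "\<exists>t. norm t \<ge> 1 \<and> (k > 0 \<longrightarrow> norm t > 1) \<and>
      (\<lambda>\<delta>. monom_series 1 (q i) \<delta> - t * monom_series 1 (q (i + k)) \<delta>) \<in> J" for i k
  proof (induction k)
    case 0
    then show ?case by (intro exI[of _ 1]) (simp add: zero)
  next
    case (Suc k)
    then obtain t where t: "norm t \<ge> 1"
        "(\<lambda>\<delta>. monom_series 1 (q i) \<delta> - t * monom_series 1 (q (i + k)) \<delta>) \<in> J" by blast
    let ?s = "s (q (i + k))"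
    have s: "norm ?s > 1"
        "(\<lambda>\<delta>. monom_series 1 (q (i + k)) \<delta> - ?s * monom_series 1 (q (i + Suc k)) \<delta>) \<in> J"
      using nx[OF qZ[of "i + k"]] by (auto simp: q_def)
    have "norm (t * ?s) > 1" using mult_right_mono[OF t(1), of "norm ?s"] s(1) by (simp add: norm_mult)
    moreover have "(\<lambda>\<delta>. monom_series 1 (q i) \<delta> - (t * ?s) * monom_series 1 (q (i + Suc k)) \<delta>) \<in> J"
      using add[OF t(2) scale[OF s(2), of t]] by (simp add: algebra_simps)
    ultimately show ?case by (intro exI[of _ "t * ?s"]) auto
  qed
  have "\<not> inj q"
  proof
    assume "inj q"
    moreover have "range q \<subseteq> Z" using qZ by blast
    ultimately show False using fin finite_subset finite_imageD infinite_UNIV_nat by blast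
  qed
  then obtain i j where ij: "i < j" "q i = q j" by (metis linorder_injI)
  obtain t where t: "norm t > 1"
      "(\<lambda>\<delta>. monom_series 1 (q i) \<delta> - t * monom_series 1 (q j) \<delta>) \<in> J"
    using chain[of "j - i" i] ij(1) by auto
  then have "(\<lambda>\<delta>. (1 - t) * monom_series 1 (q i) \<delta>) \<in> J"
    using ij(2) by (simp add: left_diff_distrib)
  moreover have "1 - t \<noteq> 0" using t(1) by auto
  ultimately have "monom_series 1 (q i) \<in> J" by (rule scale_cancel)
  \<comment> \<open>The cycle may be entered after a tail, so membership is carried back from
    \<open>q i\<close> to \<open>q 0\<close>, which is \<alpha>.\<close>
  moreover obtain u where "(\<lambda>\<delta>. monom_series 1 (q 0) \<delta> - u * monom_series 1 (q i) \<delta>) \<in> J"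
    using chain[of i 0] by auto
  ultimately have "(\<lambda>\<delta>. (monom_series 1 (q 0) \<delta> - u * monom_series 1 (q i) \<delta>)
      + u * monom_series 1 (q i) \<delta>) \<in> J"
    using add scale by blast
  then show ?thesis by (simp add: q_def)
qed

text \<open>An ideal is closed only under finite sums, so containing each monomial of a series is
  not enough by itself. One variable is peeled off at a time: the terms divisible by
  \<open>x_i ^ k i\<close> form a convergent multiple of that power, and finitely many such pieces
  add up to \<open>h\<close>.\<close>

lemma high_order_mem:
  assumes I: "finite I" "I \<subseteq> {1..n}"
    and pow: "\<And>i. i \<in> I \<Longrightarrow> monom_series 1 (Poly_Mapping.single i (k i)) \<in> J"
    and h: "h \<in> carrier (convergent_series n)"
    and supp: "\<And>\<alpha>. h \<alpha> \<noteq> 0 \<Longrightarrow> \<exists>i\<in>I. k i \<le> Poly_Mapping.lookup \<alpha> i"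
  shows "h \<in> J"
  using I pow h supp
proof (induction I arbitrary: h rule: finite_induct)
  case empty
  then have "h = (\<lambda>\<alpha>. 0)" by auto
  then show ?case by (simp add: zero)
next
  case (insert i I)
  define u where "u = (\<lambda>\<alpha>. if k i \<le> Poly_Mapping.lookup \<alpha> i then h \<alpha> else 0)"
  define v where "v = (\<lambda>\<alpha>. if \<not> k i \<le> Poly_Mapping.lookup \<alpha> i then h \<alpha> else 0)"
  have u: "u \<in> carrier (convergent_series n)" and v: "v \<in> carrier (convergent_series n)"
    unfolding u_def v_def using insert.prems(3) by (rule series_restrict_carrier)+
  obtain g where g: "g \<in> carrier (convergent_series n)"
      "u = series_mult (monom_series 1 (Poly_Mapping.single i (k i))) g"
    by (rule series_factor_monom[OF u, of "k i" i]) (auto simp: u_def split: if_splits)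
  have "u \<in> J" using mult[OF g(1) insert.prems(2)[of i]] g(2) by (simp add: series_mult_commute)
  moreover have "v \<in> J"
  proof (rule insert.IH)
    show "\<exists>i\<in>I. k i \<le> Poly_Mapping.lookup \<alpha> i" if "v \<alpha> \<noteq> 0" for \<alpha>
      using that insert.prems(4)[of \<alpha>] by (auto simp: v_def split: if_splits)
  qed (use insert.prems v in auto)
  moreover have "h = (\<lambda>\<alpha>. u \<alpha> + v \<alpha>)" by (auto simp: u_def v_def)
  ultimately show ?case using add by simp
qed

text \<open>Phrased with representatives instead of cosets: for finite \<open>B\<close> it says that
  the class of the series is a linear combination of the classes of the monomials in
  \<open>B\<close>.\<close>

definition spanned :: "monomial set \<Rightarrow> series set" where
  "spanned B = {h \<in> carrier (convergent_series n). \<exists>p\<in>carrier (convergent_series n).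
     (\<forall>\<alpha>. p \<alpha> \<noteq> 0 \<longrightarrow> \<alpha> \<in> B) \<and> (\<lambda>\<alpha>. h \<alpha> - p \<alpha>) \<in> J}"

lemma spanned_ideal: "h \<in> J \<Longrightarrow> h \<in> spanned B"
  using zero carrierI[OF zero] by (auto simp: spanned_def carrierI intro!: bexI[of _ "\<lambda>\<alpha>. 0"])

lemma spanned_supported:
  "h \<in> carrier (convergent_series n) \<Longrightarrow> (\<And>\<alpha>. h \<alpha> \<noteq> 0 \<Longrightarrow> \<alpha> \<in> B) \<Longrightarrow> h \<in> spanned B"
  using zero by (auto simp: spanned_def intro!: bexI[of _ h])

lemma spanned_add:
  assumes "g \<in> spanned B" "h \<in> spanned B"
  shows "(\<lambda>\<alpha>. g \<alpha> + h \<alpha>) \<in> spanned B"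
proof -
  from assms obtain p q where p: "p \<in> carrier (convergent_series n)" "\<forall>\<alpha>. p \<alpha> \<noteq> 0 \<longrightarrow> \<alpha> \<in> B"
      "(\<lambda>\<alpha>. g \<alpha> - p \<alpha>) \<in> J"
    and q: "q \<in> carrier (convergent_series n)" "\<forall>\<alpha>. q \<alpha> \<noteq> 0 \<longrightarrow> \<alpha> \<in> B" "(\<lambda>\<alpha>. h \<alpha> - q \<alpha>) \<in> J"
    by (auto simp: spanned_def)
  have "\<forall>\<alpha>. p \<alpha> + q \<alpha> \<noteq> 0 \<longrightarrow> \<alpha> \<in> B" using p(2) q(2) by force
  moreover have "(\<lambda>\<alpha>. g \<alpha> + h \<alpha> - (p \<alpha> + q \<alpha>)) \<in> J"
    using add[OF p(3) q(3)] by (simp add: algebra_simps)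
  ultimately show ?thesis
    using assms series_add_carrier p(1) q(1)
    by (auto simp: spanned_def intro!: bexI[of _ "\<lambda>\<alpha>. p \<alpha> + q \<alpha>"])
qed

lemma spanned_scale:
  assumes "h \<in> spanned B"
  shows "(\<lambda>\<alpha>. c * h \<alpha>) \<in> spanned B"
proof -
  from assms obtain q where q: "q \<in> carrier (convergent_series n)" "\<forall>\<alpha>. q \<alpha> \<noteq> 0 \<longrightarrow> \<alpha> \<in> B"
      "(\<lambda>\<alpha>. h \<alpha> - q \<alpha>) \<in> J"
    by (auto simp: spanned_def)
  have "(\<lambda>\<alpha>. c * h \<alpha> - c * q \<alpha>) \<in> J" using scale[OF q(3), of c] by (simp add: algebra_simps)
  moreover have "\<forall>\<alpha>. c * q \<alpha> \<noteq> 0 \<longrightarrow> \<alpha> \<in> B" using q(2) by auto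
  ultimately show ?thesis
    using assms series_scale_carrier q(1)
    by (auto simp: spanned_def intro!: bexI[of _ "\<lambda>\<alpha>. c * q \<alpha>"])
qed

lemma spanned_finite:
  assumes "finite F"
    and "\<And>\<alpha>. \<alpha> \<in> F \<Longrightarrow> Poly_Mapping.keys \<alpha> \<subseteq> {1..n} \<Longrightarrow> monom_series 1 \<alpha> \<in> spanned B"
    and "h \<in> carrier (convergent_series n)" "\<And>\<alpha>. h \<alpha> \<noteq> 0 \<Longrightarrow> \<alpha> \<in> F"
  shows "h \<in> spanned B"
  using assms
proof (induction F arbitrary: h rule: finite_induct)
  case empty
  then have "h = (\<lambda>\<alpha>. 0)" by auto
  then show ?case using spanned_ideal[OF zero] by simp
next
  case (insert \<alpha> F)
  define g where "g = (\<lambda>\<beta>. if \<beta> \<noteq> \<alpha> then h \<beta> else 0)"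
  have "g \<in> spanned B"
  proof (rule insert.IH)
    show "g \<in> carrier (convergent_series n)"
      unfolding g_def using insert.prems(2) by (rule series_restrict_carrier)
    show "\<beta> \<in> F" if "g \<beta> \<noteq> 0" for \<beta>
      using that insert.prems(3)[of \<beta>] by (auto simp: g_def split: if_splits)
  qed (use insert.prems in auto)
  moreover have "(\<lambda>\<beta>. h \<alpha> * monom_series 1 \<alpha> \<beta>) \<in> spanned B"
  proof (cases "h \<alpha> = 0")
    case True
    then show ?thesis using spanned_ideal[OF zero] by simp
  next
    case False
    then have "Poly_Mapping.keys \<alpha> \<subseteq> {1..n}"
      using insert.prems(2) by (auto simp: carrier_convergent_series)
    then show ?thesis using insert.prems(1) by (intro spanned_scale) auto
  qed
  ultimately have "(\<lambda>\<beta>. g \<beta> + h \<alpha> * monom_series 1 \<alpha> \<beta>) \<in> spanned B" by (rule spanned_add)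
  also have "(\<lambda>\<beta>. g \<beta> + h \<alpha> * monom_series 1 \<alpha> \<beta>) = h" by (auto simp: g_def monom_series_def)
  finally show ?case .
qed

subsection \<open>Dimension of a quotient with a monomial basis\<close>

definition quot_span :: "monomial set \<Rightarrow> series set set" where
  "quot_span S = (\<lambda>p. J +>\<^bsub>convergent_series n\<^esub> p) `
     {p \<in> carrier (convergent_series n). \<forall>\<alpha>. p \<alpha> \<noteq> 0 \<longrightarrow> \<alpha> \<in> S}"

lemma coset_eq_iff:
  assumes "g \<in> carrier (convergent_series n)" "h \<in> carrier (convergent_series n)"
  shows "J +>\<^bsub>convergent_series n\<^esub> g = J +>\<^bsub>convergent_series n\<^esub> h \<longleftrightarrow> (\<lambda>\<alpha>. g \<alpha> - h \<alpha>) \<in> J"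
proof -
  interpret cring "convergent_series n" by (rule cring_convergent_series)
  show ?thesis
    using quotient_eq_iff_same_a_r_cos[OF ideal assms] assms by (simp add: convergent_series_minus)
qed

text \<open>Each further monomial adds one dimension: independence keeps its class out of the span
  so far, and the enlarged span is exactly the \<open>line_extension\<close> by that class, which
  matches the inductive rule for \<open>dimension\<close>.\<close>

lemma dimension_quot_span:
  assumes fin: "finite S"
    and keys: "\<And>\<alpha>. \<alpha> \<in> S \<Longrightarrow> Poly_Mapping.keys \<alpha> \<subseteq> {1..n}"
    and indep: "\<And>p. p \<in> J \<Longrightarrow> (\<And>\<alpha>. p \<alpha> \<noteq> 0 \<Longrightarrow> \<alpha> \<in> S) \<Longrightarrow> p = (\<lambda>\<alpha>. 0)"
  shows "ring.dimension (convergent_series n Quot J) (card S)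
           (range (\<lambda>c. J +>\<^bsub>convergent_series n\<^esub> const_series c)) (quot_span S)"
  using fin keys indep
proof (induction S rule: finite_induct)
  case empty
  interpret R: cring "convergent_series n" by (rule cring_convergent_series)
  interpret Q: ring "convergent_series n Quot J" by (rule ideal.quotient_is_ring[OF ideal])
  have "{p \<in> carrier (convergent_series n). \<forall>\<alpha>. p \<alpha> \<noteq> 0 \<longrightarrow> \<alpha> \<in> {}} = {\<lambda>\<alpha>. 0}"
    using carrierI[OF zero] by auto
  then have "quot_span {} = {\<zero>\<^bsub>convergent_series n Quot J\<^esub>}"
    using R.a_rcos_zero[OF ideal zero] by (simp add: quot_span_def FactRing_def)
  then show ?case using Q.zero_dim by simp
next
  case (insert \<beta> S)
  let ?R = "convergent_series n" and ?Q = "convergent_series n Quot J"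
  let ?K = "range (\<lambda>c. J +>\<^bsub>?R\<^esub> const_series c)"
  interpret R: cring ?R by (rule cring_convergent_series)
  interpret Q: ring ?Q by (rule ideal.quotient_is_ring[OF ideal])
  interpret h: ring_hom_ring ?R ?Q "\<lambda>p. J +>\<^bsub>?R\<^esub> p" by (rule ideal.rcos_ring_hom_ring[OF ideal])
  let ?m = "monom_series 1 \<beta>"
  have m: "?m \<in> carrier ?R" using insert.prems(1) by (simp add: monom_series_carrier)
  have dim: "Q.dimension (card S) ?K (quot_span S)"
    using insert.prems by (intro insert.IH) auto
  have notin: "J +>\<^bsub>?R\<^esub> ?m \<notin> quot_span S"
  proof
    assume "J +>\<^bsub>?R\<^esub> ?m \<in> quot_span S"
    then obtain p where p: "p \<in> carrier ?R" "\<forall>\<alpha>. p \<alpha> \<noteq> 0 \<longrightarrow> \<alpha> \<in> S"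
        "J +>\<^bsub>?R\<^esub> ?m = J +>\<^bsub>?R\<^esub> p"
      by (auto simp: quot_span_def)
    then have "(\<lambda>\<alpha>. ?m \<alpha> - p \<alpha>) \<in> J" using coset_eq_iff[OF m p(1)] by simp
    \<comment> \<open>The difference is supported on \<open>insert \<beta> S\<close>, where
      independence applies; but its coefficient at \<beta> is 1, because \<beta> is not in
      \<open>S\<close>.\<close>
    then have "(\<lambda>\<alpha>. ?m \<alpha> - p \<alpha>) = (\<lambda>\<alpha>. 0)"
      by (rule insert.prems(2)) (use p(2) in \<open>auto simp: monom_series_def split: if_splits\<close>)
    from fun_cong[OF this, of \<beta>] p(2) insert.hyps(2) show False by (auto simp: monom_series_def)
  qed
  have comb: "J +>\<^bsub>?R\<^esub> (\<lambda>\<alpha>. c * ?m \<alpha> + p \<alpha>) =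
      (J +>\<^bsub>?R\<^esub> const_series c) \<otimes>\<^bsub>?Q\<^esub> (J +>\<^bsub>?R\<^esub> ?m) \<oplus>\<^bsub>?Q\<^esub> (J +>\<^bsub>?R\<^esub> p)"
    if p: "p \<in> carrier ?R" for c p
    using h.hom_add[OF series_scale_carrier[OF m] p, of c] h.hom_mult[OF const_series_carrier m, of c]
    by (simp only: convergent_series_simps series_mult_const)
  have ext: "Q.line_extension ?K (J +>\<^bsub>?R\<^esub> ?m) (quot_span S) = quot_span (insert \<beta> S)"
  proof (intro equalityI subsetI)
    fix w assume "w \<in> Q.line_extension ?K (J +>\<^bsub>?R\<^esub> ?m) (quot_span S)"
    then obtain c p where p: "p \<in> carrier ?R" "\<forall>\<alpha>. p \<alpha> \<noteq> 0 \<longrightarrow> \<alpha> \<in> S"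
        and w: "w = (J +>\<^bsub>?R\<^esub> const_series c) \<otimes>\<^bsub>?Q\<^esub> (J +>\<^bsub>?R\<^esub> ?m) \<oplus>\<^bsub>?Q\<^esub> (J +>\<^bsub>?R\<^esub> p)"
      by (auto simp: Q.line_extension_mem_iff quot_span_def)
    let ?q = "\<lambda>\<alpha>. c * ?m \<alpha> + p \<alpha>"
    have "w = J +>\<^bsub>?R\<^esub> ?q"
      using w comb[OF p(1)] by simp
    moreover have "?q \<in> carrier ?R"
      by (intro series_add_carrier series_scale_carrier m p(1))
    moreover have "\<forall>\<alpha>. ?q \<alpha> \<noteq> 0 \<longrightarrow> \<alpha> \<in> insert \<beta> S"
      using p(2) by (auto simp: monom_series_def)
    ultimately show "w \<in> quot_span (insert \<beta> S)" by (simp add: quot_span_def)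
  next
    fix w assume "w \<in> quot_span (insert \<beta> S)"
    then obtain q where q: "q \<in> carrier ?R" "\<forall>\<alpha>. q \<alpha> \<noteq> 0 \<longrightarrow> \<alpha> \<in> insert \<beta> S" "w = J +>\<^bsub>?R\<^esub> q"
      by (auto simp: quot_span_def)
    define p where "p = (\<lambda>\<alpha>. if \<alpha> \<noteq> \<beta> then q \<alpha> else 0)"
    have p: "p \<in> carrier ?R" unfolding p_def using q(1) by (rule series_restrict_carrier)
    have pS: "\<forall>\<alpha>. p \<alpha> \<noteq> 0 \<longrightarrow> \<alpha> \<in> S" using q(2) by (auto simp: p_def)
    have "q = (\<lambda>\<alpha>. q \<beta> * ?m \<alpha> + p \<alpha>)" by (auto simp: p_def monom_series_def)
    then have "w = J +>\<^bsub>?R\<^esub> (\<lambda>\<alpha>. q \<beta> * ?m \<alpha> + p \<alpha>)"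
      unfolding q(3) by (rule arg_cong)
    also have "\<dots> = (J +>\<^bsub>?R\<^esub> const_series (q \<beta>)) \<otimes>\<^bsub>?Q\<^esub> (J +>\<^bsub>?R\<^esub> ?m) \<oplus>\<^bsub>?Q\<^esub> (J +>\<^bsub>?R\<^esub> p)"
      by (rule comb[OF p])
    finally show "w \<in> Q.line_extension ?K (J +>\<^bsub>?R\<^esub> ?m) (quot_span S)"
      using p pS by (auto simp: Q.line_extension_mem_iff quot_span_def)
  qed
  show ?case
    using Q.Suc_dim[OF h.hom_closed[OF m] notin dim] insert.hyps by (simp add: ext)
qed

text \<open>The constants form a subfield of the ring of series, and a ring homomorphism into a
  nonzero ring maps subfields to subfields. Uniqueness of the dimension of the quotient rests on
  this.\<close>

lemma subfield_scalars:
  assumes "const_series 1 \<notin> J"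
  shows "subfield (range (\<lambda>c. J +>\<^bsub>convergent_series n\<^esub> const_series c)) (convergent_series n Quot J)"
proof -
  let ?R = "convergent_series n" and ?Q = "convergent_series n Quot J"
  interpret R: cring ?R by (rule cring_convergent_series)
  interpret h: ring_hom_ring ?R ?Q "\<lambda>p. J +>\<^bsub>?R\<^esub> p" by (rule ideal.rcos_ring_hom_ring[OF ideal])
  have inj: "const_series c = const_series e \<longleftrightarrow> c = e" for c e
    by (auto simp: const_series_def fun_eq_iff)
  have zero: "const_series 0 = (\<lambda>\<alpha>. 0)" by (auto simp: const_series_def)
  have mult: "series_mult (const_series c) (const_series e) = const_series (c * e)" for c e
    by (simp add: const_series_eq series_mult_monom_monom)
  have add: "(\<lambda>\<alpha>. const_series c \<alpha> + const_series e \<alpha>) = const_series (c + e)" for c e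
    by (auto simp: const_series_def)
  have minus: "\<ominus>\<^bsub>?R\<^esub> const_series c = const_series (- c)" for c
    by (rule R.minus_equality) (auto simp: const_series_carrier add zero[symmetric])
  have "subfield (range const_series) ?R"
  proof (rule R.subfieldI)
    show "subcring (range const_series) ?R"
    proof (rule R.subcringI')
      show "subring (range const_series) ?R"
        by (rule R.subringI) (auto simp: const_series_carrier mult add minus)
    qed
    show "Units (?R\<lparr>carrier := range const_series\<rparr>) = range const_series - {\<zero>\<^bsub>?R\<^esub>}"
    proof (intro equalityI subsetI)
      fix a assume "a \<in> Units (?R\<lparr>carrier := range const_series\<rparr>)"
      then obtain c e where "a = const_series c" "const_series (c * e) = const_series 1"
        by (auto simp: Units_def mult)
      then show "a \<in> range const_series - {\<zero>\<^bsub>?R\<^esub>}"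
        by (auto simp: inj zero[symmetric])
    next
      fix a assume "a \<in> range const_series - {\<zero>\<^bsub>?R\<^esub>}"
      then obtain c where "a = const_series c" "c \<noteq> 0" by (auto simp: inj zero[symmetric])
      then show "a \<in> Units (?R\<lparr>carrier := range const_series\<rparr>)"
        by (auto simp: Units_def mult intro!: exI[of _ "inverse c"])
    qed
  qed
  moreover have "\<one>\<^bsub>?Q\<^esub> \<noteq> \<zero>\<^bsub>?Q\<^esub>"
  proof
    assume "\<one>\<^bsub>?Q\<^esub> = \<zero>\<^bsub>?Q\<^esub>"
    then have "J +>\<^bsub>?R\<^esub> const_series 1 = J" by (simp add: FactRing_def)
    then have "const_series 1 \<in> J"
      using ideal.rcos_const_imp_mem[OF ideal const_series_carrier] by blast
    with assms show False by simp
  qed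
  ultimately have "subfield ((\<lambda>p. J +>\<^bsub>?R\<^esub> p) ` range const_series) ?Q"
    by (rule h.img_is_subfield)
  then show ?thesis by (simp add: image_image)
qed

end

text \<open>Spanning and independence make \<open>card B\<close> a dimension. The condition
  \<open>0 \<in> B\<close> lets independence exclude the constant 1 from the ideal, so the scalars
  form a field and the value chosen by \<open>THE\<close> is unique.\<close>

lemma milnor_number_eqI:
  assumes B: "finite B" "\<And>\<alpha>. \<alpha> \<in> B \<Longrightarrow> Poly_Mapping.keys \<alpha> \<subseteq> {1..n}" "0 \<in> B"
    and J: "series_ideal n (jacobian_ideal n f)"
    and span: "carrier (convergent_series n) \<subseteq> series_ideal.spanned n (jacobian_ideal n f) B"
    and indep: "\<And>p. p \<in> jacobian_ideal n f \<Longrightarrow> (\<And>\<alpha>. p \<alpha> \<noteq> 0 \<Longrightarrow> \<alpha> \<in> B) \<Longrightarrow> p = (\<lambda>\<alpha>. 0)"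
  shows "milnor_number n f = enat (card B)"
proof -
  interpret series_ideal n "jacobian_ideal n f" by (rule J)
  interpret Q: ring "milnor_algebra n f"
    unfolding milnor_algebra_def by (rule ideal.quotient_is_ring[OF ideal])
  have "quot_span B = carrier (milnor_algebra n f)"
  proof (intro equalityI subsetI)
    fix w assume "w \<in> carrier (milnor_algebra n f)"
    then obtain h where h: "h \<in> carrier (convergent_series n)"
        "w = jacobian_ideal n f +>\<^bsub>convergent_series n\<^esub> h"
      by (auto simp: milnor_algebra_def FactRing_def A_RCOSETS_def')
    with span obtain p where "p \<in> carrier (convergent_series n)" "\<forall>\<alpha>. p \<alpha> \<noteq> 0 \<longrightarrow> \<alpha> \<in> B"
        "(\<lambda>\<alpha>. h \<alpha> - p \<alpha>) \<in> jacobian_ideal n f"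
      by (auto simp: spanned_def)
    with h coset_eq_iff[OF h(1)] show "w \<in> quot_span B" by (auto simp: quot_span_def)
  qed (auto simp: quot_span_def milnor_algebra_def FactRing_def A_RCOSETS_def')
  with dimension_quot_span[OF B(1,2) indep]
  have dim: "Q.dimension (card B) (milnor_scalars n f) (carrier (milnor_algebra n f))"
    by (simp add: milnor_algebra_def milnor_scalars_def)
  have "const_series 1 \<notin> jacobian_ideal n f"
  proof
    assume "const_series 1 \<in> jacobian_ideal n f"
    then have "const_series 1 = (\<lambda>\<alpha>. 0)"
      by (rule indep) (use B(3) in \<open>auto simp: const_series_def split: if_splits\<close>)
    from fun_cong[OF this, of 0] show False by (simp add: const_series_def)
  qed
  from subfield_scalars[OF this] have K: "subfield (milnor_scalars n f) (milnor_algebra n f)"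
    by (simp add: milnor_algebra_def milnor_scalars_def)
  have "(THE k. Q.dimension k (milnor_scalars n f) (carrier (milnor_algebra n f))) = card B"
    using dim by (rule the_equality) (rule Q.dimension_is_inj[OF K _ dim])
  moreover have "\<exists>k. Q.dimension k (milnor_scalars n f) (carrier (milnor_algebra n f))"
    using dim by (rule exI)
  ultimately show ?thesis by (simp add: milnor_number_def)
qed

subsection \<open>The Jacobian ideal of the loop polynomial\<close>

text \<open>If \<open>x_i\<close> does not occur in \<mu>, the truncated subtraction leaves \<mu>
  unchanged, but then the coefficient is 0.\<close>

lemma partial_series_monom:
  "partial_series i (monom_series c \<mu>) =
     monom_series (of_nat (Poly_Mapping.lookup \<mu> i) * c) (\<mu> - Poly_Mapping.single i 1)"
proof
  fix \<alpha> :: monomial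
  show "partial_series i (monom_series c \<mu>) \<alpha> =
     monom_series (of_nat (Poly_Mapping.lookup \<mu> i) * c) (\<mu> - Poly_Mapping.single i 1) \<alpha>"
  proof (cases "\<alpha> + Poly_Mapping.single i 1 = \<mu>")
    case True
    then have "\<alpha> = \<mu> - Poly_Mapping.single i 1" "Poly_Mapping.lookup \<mu> i = Poly_Mapping.lookup \<alpha> i + 1"
      by (auto simp: lookup_add)
    with True show ?thesis by (simp add: partial_series_def monom_series_def)
  next
    case False
    have "Poly_Mapping.lookup \<mu> i = 0" if "\<alpha> = \<mu> - Poly_Mapping.single i 1"
    proof (rule ccontr)
      assume "Poly_Mapping.lookup \<mu> i \<noteq> 0"
      with that have "\<alpha> + Poly_Mapping.single i 1 = \<mu>"
        by (intro poly_mapping_eqI) (auto simp: lookup_add lookup_minus lookup_single when_def)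
      with False show False by simp
    qed
    with False show ?thesis by (auto simp: partial_series_def monom_series_def)
  qed
qed

lemma var_power: "var i ^ k = Poly_Mapping.single (Poly_Mapping.single i k) 1"
  by (induction k) (simp_all add: var_def mult_single flip: single_add)

locale loop =
  fixes n :: nat and d :: "nat \<Rightarrow> nat"
  assumes odd_n: "odd n" and d_ge_2: "\<And>i. i \<in> {1..n} \<Longrightarrow> 2 \<le> d i"
begin

text \<open>\<open>sg\<close> and \<open>pr\<close> are successor and predecessor on the cycle of
  indices. For \<open>n = 1\<close> both fix 1, in accordance with the convention for the
  one-variable polynomial.\<close>

definition sg :: "nat \<Rightarrow> nat" where "sg i = (if i = n then 1 else i + 1)"
definition pr :: "nat \<Rightarrow> nat" where "pr i = (if i = 1 then n else i - 1)"

lemma n_pos: "n \<ge> 1"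
  using odd_n by (cases n) auto

lemma sg_mem: "i \<in> {1..n} \<Longrightarrow> sg i \<in> {1..n}"
  using n_pos by (auto simp: sg_def)

lemma pr_mem: "i \<in> {1..n} \<Longrightarrow> pr i \<in> {1..n}"
  using n_pos by (auto simp: pr_def)

lemma pr_sg: "i \<in> {1..n} \<Longrightarrow> pr (sg i) = i"
  using n_pos by (auto simp: sg_def pr_def)

lemma sg_pr: "i \<in> {1..n} \<Longrightarrow> sg (pr i) = i"
  using n_pos by (auto simp: sg_def pr_def)

text \<open>The i-th term of the loop polynomial.\<close>

definition cycle_monomial :: "nat \<Rightarrow> monomial" where
  "cycle_monomial i = Poly_Mapping.single i (d i) + Poly_Mapping.single (sg i) 1"

text \<open>What replaces \<open>x_i ^ d i\<close> in a reduction: the mixed monomial of the partial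
  derivative in the direction \<open>sg i\<close>.\<close>

definition reduct :: "nat \<Rightarrow> monomial" where
  "reduct i = Poly_Mapping.single (sg i) (d (sg i) - 1) + Poly_Mapping.single (sg (sg i)) 1"

lemma keys_reduct: "i \<in> {1..n} \<Longrightarrow> Poly_Mapping.keys (reduct i) \<subseteq> {1..n}"
  using sg_mem[of i] sg_mem[of "sg i"] by (auto simp: reduct_def keys_add_monomial split: if_splits)

lemma loop_poly_eq:
  "loop_poly n d = (\<Sum>i\<in>{1..n}. Poly_Mapping.single (cycle_monomial i) 1)"
  unfolding loop_poly_def
  by (rule sum.cong[OF refl], unfold var_power) (simp add: var_def mult_single cycle_monomial_def sg_def)

abbreviation f :: series where "f \<equiv> Poly_Mapping.lookup (loop_poly n d)"

lemma f_eq: "f = (\<lambda>\<alpha>. \<Sum>i\<in>{1..n}. monom_series 1 (cycle_monomial i) \<alpha>)"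
  by (auto simp: fun_eq_iff loop_poly_eq lookup_sum lookup_single monom_series_def when_def intro!: sum.cong)

text \<open>The variable \<open>x_i\<close> occurs only in the terms \<open>i\<close> and
  \<open>pr i\<close>. The two contributions are added rather than separated into cases because for
  \<open>n = 1\<close> both come from the same term and give
  \<open>(d 1 + 1) x_1 ^ d 1\<close>.\<close>

lemma partial_cycle_monomial:
  assumes i: "i \<in> {1..n}" and j: "j \<in> {1..n}"
  shows "partial_series i (monom_series 1 (cycle_monomial j)) \<alpha> =
    (if j = pr i then monom_series 1 (Poly_Mapping.single (pr i) (d (pr i))) \<alpha> else 0) +
    (if j = i then of_nat (d i) *
       monom_series 1 (Poly_Mapping.single i (d i - 1) + Poly_Mapping.single (sg i) 1) \<alpha> else 0)"
proof -
  have d: "d i \<ge> 2" using d_ge_2[OF i] .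
  have l: "Poly_Mapping.lookup (cycle_monomial j) i =
      (if j = i then d i else 0) + (if j = pr i then 1 else 0)"
    using sg_pr[OF i] pr_sg[OF j] by (auto simp: cycle_monomial_def lookup_add lookup_single when_def)
  have 1: "cycle_monomial j - Poly_Mapping.single i 1 = Poly_Mapping.single j (d j)" if "j = pr i"
    using sg_pr[OF i] that by (simp add: cycle_monomial_def)
  have 2: "cycle_monomial i - Poly_Mapping.single i 1 =
      Poly_Mapping.single i (d i - 1) + Poly_Mapping.single (sg i) 1"
    using d by (intro poly_mapping_eqI)
      (auto simp: cycle_monomial_def lookup_add lookup_minus lookup_single when_def)
  show ?thesis
    unfolding partial_series_monom l
    using 1 2 by (auto simp: monom_series_def)
qed

lemma partial_f:
  assumes i: "i \<in> {1..n}"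
  shows "partial_series i f =
    (\<lambda>\<alpha>. monom_series 1 (Poly_Mapping.single (pr i) (d (pr i))) \<alpha> +
       of_nat (d i) * monom_series 1 (Poly_Mapping.single i (d i - 1) + Poly_Mapping.single (sg i) 1) \<alpha>)"
proof
  fix \<alpha>
  have "partial_series i f \<alpha> = (\<Sum>j\<in>{1..n}. partial_series i (monom_series 1 (cycle_monomial j)) \<alpha>)"
    by (simp add: f_eq partial_series_def sum_distrib_left)
  also have "\<dots> = monom_series 1 (Poly_Mapping.single (pr i) (d (pr i))) \<alpha> +
       of_nat (d i) * monom_series 1 (Poly_Mapping.single i (d i - 1) + Poly_Mapping.single (sg i) 1) \<alpha>"
    using i pr_mem[OF i] by (simp add: partial_cycle_monomial sum.distrib del: One_nat_def)
  finally show "partial_series i f \<alpha> =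
       monom_series 1 (Poly_Mapping.single (pr i) (d (pr i))) \<alpha> +
       of_nat (d i) * monom_series 1 (Poly_Mapping.single i (d i - 1) + Poly_Mapping.single (sg i) 1) \<alpha>" .
qed

abbreviation J :: "series set" where "J \<equiv> jacobian_ideal n f"

lemma partial_f_carrier: "i \<in> {1..n} \<Longrightarrow> partial_series i f \<in> carrier (convergent_series n)"
  using pr_mem[of i] sg_mem[of i] unfolding partial_f
  by (intro series_add_carrier series_scale_carrier monom_series_carrier)
     (auto simp: keys_add_monomial split: if_splits)

lemma partial_f_subset: "(\<lambda>i. partial_series i f) ` {1..n} \<subseteq> carrier (convergent_series n)"
  using partial_f_carrier by blast

sublocale J: series_ideal n J
proof (rule series_ideal.intro)
  interpret cring "convergent_series n" by (rule cring_convergent_series)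
  show "ideal J (convergent_series n)"
    unfolding jacobian_ideal_def using partial_f_subset by (rule genideal_ideal)
qed

lemma partial_f_mem:
  assumes "i \<in> {1..n}"
  shows "partial_series i f \<in> J"
proof -
  interpret cring "convergent_series n" by (rule cring_convergent_series)
  show ?thesis
    using genideal_self[OF partial_f_subset] assms unfolding jacobian_ideal_def by blast
qed

text \<open>This is the monomial \<gamma> times the partial derivative in the direction
  \<open>sg i\<close>, the one containing the pure power of \<open>x_i\<close>, written as a
  difference so that the factor of the reduction is visible.\<close>

lemma reduction_mem:
  assumes i: "i \<in> {1..n}" and \<gamma>: "Poly_Mapping.keys \<gamma> \<subseteq> {1..n}"
  shows "(\<lambda>\<alpha>. monom_series 1 (\<gamma> + Poly_Mapping.single i (d i)) \<alpha> -
           (- of_nat (d (sg i))) * monom_series 1 (\<gamma> + reduct i) \<alpha>) \<in> J"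
proof -
  have "series_mult (monom_series 1 \<gamma>) (partial_series (sg i) f) \<in> J"
    by (intro J.mult monom_series_carrier \<gamma> partial_f_mem sg_mem i)
  also have "series_mult (monom_series 1 \<gamma>) (partial_series (sg i) f) =
      (\<lambda>\<alpha>. monom_series 1 (\<gamma> + Poly_Mapping.single i (d i)) \<alpha> +
           series_mult (const_series (of_nat (d (sg i)))) (monom_series 1 (\<gamma> + reduct i)) \<alpha>)"
    unfolding partial_f[OF sg_mem[OF i]] pr_sg[OF i]
    by (subst series_mult_commute, subst series_mult_add_left)
       (simp add: series_mult_const[symmetric] series_mult_assoc series_mult_monom_monom
          reduct_def add.commute add.left_commute)
  finally show ?thesis by (simp add: series_mult_const)
qed

text \<open>Reducing one term of the loop polynomial yields the next term, so the multiples of the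
  \<open>n\<close> terms by a fixed \<gamma> form a finite set closed under reductions.\<close>

lemma cycle_multiple_mem:
  assumes i: "i \<in> {1..n}" and \<gamma>: "Poly_Mapping.keys \<gamma> \<subseteq> {1..n}"
  shows "monom_series 1 (\<gamma> + cycle_monomial i) \<in> J"
proof (rule J.expanding_monomials_mem)
  let ?Z = "(\<lambda>i. \<gamma> + cycle_monomial i) ` {1..n}"
  show "finite ?Z" by simp
  show "\<gamma> + cycle_monomial i \<in> ?Z" using i by blast
  fix \<alpha> assume "\<alpha> \<in> ?Z"
  then obtain j where j: "j \<in> {1..n}" "\<alpha> = \<gamma> + cycle_monomial j" by blast
  have d: "d (sg j) \<ge> 2" using d_ge_2[OF sg_mem[OF j(1)]] .
  have "Poly_Mapping.keys (\<gamma> + Poly_Mapping.single (sg j) 1) \<subseteq> {1..n}"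
    using \<gamma> sg_mem[OF j(1)] by (auto simp: keys_add_monomial)
  from reduction_mem[OF j(1) this]
  have "(\<lambda>\<delta>. monom_series 1 (\<gamma> + Poly_Mapping.single (sg j) 1 + Poly_Mapping.single j (d j)) \<delta> -
      (- of_nat (d (sg j))) * monom_series 1 (\<gamma> + Poly_Mapping.single (sg j) 1 + reduct j) \<delta>) \<in> J" .
  also have "\<gamma> + Poly_Mapping.single (sg j) 1 + Poly_Mapping.single j (d j) = \<alpha>"
    by (simp add: j(2) cycle_monomial_def ac_simps)
  \<comment> \<open>The factor \<open>x_(sg j)\<close> kept in the cofactor completes the exponent
    \<open>d (sg j) - 1\<close> of the reduct to \<open>d (sg j)\<close>.\<close>
  also have "\<gamma> + Poly_Mapping.single (sg j) 1 + reduct j = \<gamma> + cycle_monomial (sg j)"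
    using d by (intro poly_mapping_eqI)
      (auto simp: reduct_def cycle_monomial_def lookup_add lookup_single when_def)
  finally have "(\<lambda>\<delta>. monom_series 1 \<alpha> \<delta> -
      (- of_nat (d (sg j))) * monom_series 1 (\<gamma> + cycle_monomial (sg j)) \<delta>) \<in> J" .
  moreover have "norm (- of_nat (d (sg j)) :: complex) > 1" using d by simp
  moreover have "\<gamma> + cycle_monomial (sg j) \<in> ?Z" using sg_mem[OF j(1)] by blast
  ultimately show "\<exists>\<beta>\<in>?Z. \<exists>s. norm s > 1 \<and>
      (\<lambda>\<delta>. monom_series 1 \<alpha> \<delta> - s * monom_series 1 \<beta> \<delta>) \<in> J" by blast
qed

text \<open>Reducing one of the two factors \<open>x_i ^ d i\<close> produces a power of
  \<open>x_(sg i)\<close> with exponent \<open>d (sg i) - 1\<close>, which is at least 1. Together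
  with the remaining factor \<open>x_i ^ d i\<close> it contains the i-th term of the loop
  polynomial.\<close>

lemma double_power_mem:
  assumes i: "i \<in> {1..n}" and \<gamma>: "Poly_Mapping.keys \<gamma> \<subseteq> {1..n}"
  shows "monom_series 1 (\<gamma> + Poly_Mapping.single i (2 * d i)) \<in> J"
proof -
  have d: "d (sg i) \<ge> 2" using d_ge_2[OF sg_mem[OF i]] .
  let ?\<gamma> = "\<gamma> + Poly_Mapping.single i (d i)"
  let ?\<gamma>' = "\<gamma> + Poly_Mapping.single (sg i) (d (sg i) - 2) + Poly_Mapping.single (sg (sg i)) 1"
  have k: "Poly_Mapping.keys ?\<gamma> \<subseteq> {1..n}" "Poly_Mapping.keys ?\<gamma>' \<subseteq> {1..n}"
    using \<gamma> i sg_mem[OF i] sg_mem[OF sg_mem[OF i]] by (auto simp: keys_add_monomial split: if_splits)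
  have "?\<gamma> + reduct i = ?\<gamma>' + cycle_monomial i"
    using d by (intro poly_mapping_eqI)
      (auto simp: reduct_def cycle_monomial_def lookup_add lookup_single when_def)
  then have "monom_series 1 (?\<gamma> + reduct i) \<in> J"
    using cycle_multiple_mem[OF i k(2)] by simp
  then have "(\<lambda>\<alpha>. (- of_nat (d (sg i))) * monom_series 1 (?\<gamma> + reduct i) \<alpha>) \<in> J"
    by (rule J.scale)
  from J.add[OF reduction_mem[OF i k(1)] this]
  have "monom_series 1 (?\<gamma> + Poly_Mapping.single i (d i)) \<in> J" by simp
  also have "?\<gamma> + Poly_Mapping.single i (d i) = \<gamma> + Poly_Mapping.single i (2 * d i)"
    by (simp add: add.assoc mult_2 flip: single_add)
  finally show ?thesis .
qed

section \<open>The box spans the Milnor algebra\<close>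

definition box :: "monomial set" where
  "box = {\<alpha>. Poly_Mapping.keys \<alpha> \<subseteq> {1..n} \<and> (\<forall>i\<in>{1..n}. Poly_Mapping.lookup \<alpha> i < d i)}"

definition big_box :: "monomial set" where
  "big_box = {\<alpha>. Poly_Mapping.keys \<alpha> \<subseteq> {1..n} \<and> (\<forall>i\<in>{1..n}. Poly_Mapping.lookup \<alpha> i < 2 * d i)}"

lemma outside_big_box_mem:
  assumes "Poly_Mapping.keys \<alpha> \<subseteq> {1..n}" "\<alpha> \<notin> big_box"
  shows "monom_series 1 \<alpha> \<in> J"
proof -
  obtain i where i: "i \<in> {1..n}" "2 * d i \<le> Poly_Mapping.lookup \<alpha> i"
    using assms by (auto simp: big_box_def not_less)
  have "Poly_Mapping.keys (\<alpha> - Poly_Mapping.single i (2 * d i)) \<subseteq> {1..n}"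
    using assms(1) keys_diff_monomial by blast
  from double_power_mem[OF i(1) this] split_power[OF i(2)] show ?thesis by simp
qed

text \<open>No termination order is used. The monomials that are not spanned lie in the finite
  \<open>big_box\<close> and outside \<open>box\<close>, so each can be reduced, and its reduct is
  again not spanned. They form a finite set closed under expanding reductions, hence lie in the
  ideal and are spanned after all.\<close>

lemma monom_spanned:
  assumes \<alpha>: "Poly_Mapping.keys \<alpha> \<subseteq> {1..n}"
  shows "monom_series 1 \<alpha> \<in> J.spanned box"
proof (rule ccontr)
  assume bad: "monom_series 1 \<alpha> \<notin> J.spanned box"
  define Z where "Z = {\<alpha> \<in> big_box. monom_series 1 \<alpha> \<notin> J.spanned box}"
  have Z: "\<beta> \<in> Z" if "Poly_Mapping.keys \<beta> \<subseteq> {1..n}" "monom_series 1 \<beta> \<notin> J.spanned box" for \<beta>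
    using that outside_big_box_mem J.spanned_ideal by (auto simp: Z_def)
  have "monom_series 1 \<alpha> \<in> J"
  proof (rule J.expanding_monomials_mem)
    show "finite Z"
      unfolding Z_def big_box_def
      by (rule finite_subset[OF _ finite_bounded_monomials[of "{1..n}" "\<lambda>i. 2 * d i"]]) auto
    show "\<alpha> \<in> Z" using Z \<alpha> bad by blast
    fix \<alpha> assume "\<alpha> \<in> Z"
    then have k: "Poly_Mapping.keys \<alpha> \<subseteq> {1..n}" and ns: "monom_series 1 \<alpha> \<notin> J.spanned box"
      by (auto simp: Z_def big_box_def)
    have "\<alpha> \<notin> box"
    proof
      assume "\<alpha> \<in> box"
      then have "monom_series 1 \<alpha> \<in> J.spanned box"
        by (intro J.spanned_supported monom_series_carrier k) (auto simp: monom_series_def split: if_splits)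
      with ns show False by simp
    qed
    with k obtain i where i: "i \<in> {1..n}" "d i \<le> Poly_Mapping.lookup \<alpha> i"
      by (auto simp: box_def not_less)
    let ?\<gamma> = "\<alpha> - Poly_Mapping.single i (d i)" and ?s = "- of_nat (d (sg i)) :: complex"
    have k': "Poly_Mapping.keys ?\<gamma> \<subseteq> {1..n}" using k keys_diff_monomial by blast
    have red: "(\<lambda>\<delta>. monom_series 1 \<alpha> \<delta> - ?s * monom_series 1 (?\<gamma> + reduct i) \<delta>) \<in> J"
      using reduction_mem[OF i(1) k'] split_power[OF i(2)] by simp
    have "?\<gamma> + reduct i \<in> Z"
    proof (rule Z)
      show "Poly_Mapping.keys (?\<gamma> + reduct i) \<subseteq> {1..n}"
        using k' keys_reduct[OF i(1)] by (auto simp: keys_add_monomial)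
      show "monom_series 1 (?\<gamma> + reduct i) \<notin> J.spanned box"
      proof
        assume "monom_series 1 (?\<gamma> + reduct i) \<in> J.spanned box"
        from J.spanned_add[OF J.spanned_ideal[OF red] J.spanned_scale[OF this, of ?s]] ns
        show False by simp
      qed
    qed
    moreover have "norm ?s > 1" using d_ge_2[OF sg_mem[OF i(1)]] by simp
    ultimately show "\<exists>\<beta>\<in>Z. \<exists>s. norm s > 1 \<and>
        (\<lambda>\<delta>. monom_series 1 \<alpha> \<delta> - s * monom_series 1 \<beta> \<delta>) \<in> J" using red by blast
  qed
  with bad J.spanned_ideal show False by blast
qed

text \<open>The series is cut at \<open>big_box\<close>: the finite part is spanned monomial by
  monomial, and the infinite rest lies in the ideal because each of its terms is divisible by some
  \<open>x_i ^ (2 * d i)\<close>.\<close>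

lemma series_spanned: "carrier (convergent_series n) \<subseteq> J.spanned box"
proof
  fix h assume h: "h \<in> carrier (convergent_series n)"
  define u where "u = (\<lambda>\<alpha>. if \<alpha> \<in> big_box then h \<alpha> else 0)"
  define v where "v = (\<lambda>\<alpha>. if \<alpha> \<notin> big_box then h \<alpha> else 0)"
  have "u \<in> J.spanned box"
  proof (rule J.spanned_finite)
    show "finite big_box" unfolding big_box_def by (rule finite_bounded_monomials) simp
    show "u \<in> carrier (convergent_series n)" unfolding u_def using h by (rule series_restrict_carrier)
  qed (auto simp: u_def monom_spanned split: if_splits)
  moreover have "v \<in> J"
  proof (rule J.high_order_mem[where I = "{1..n}" and k = "\<lambda>i. 2 * d i"])
    show "v \<in> carrier (convergent_series n)" unfolding v_def using h by (rule series_restrict_carrier)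
    show "monom_series 1 (Poly_Mapping.single i (2 * d i)) \<in> J" if "i \<in> {1..n}" for i
      using double_power_mem[OF that, of 0] by simp
    show "\<exists>i\<in>{1..n}. 2 * d i \<le> Poly_Mapping.lookup \<alpha> i" if "v \<alpha> \<noteq> 0" for \<alpha>
      using that h by (auto simp: v_def big_box_def carrier_convergent_series not_less split: if_splits)
  qed auto
  ultimately have "(\<lambda>\<alpha>. u \<alpha> + v \<alpha>) \<in> J.spanned box"
    using J.spanned_add J.spanned_ideal by blast
  also have "(\<lambda>\<alpha>. u \<alpha> + v \<alpha>) = h" by (auto simp: u_def v_def)
  finally show "h \<in> J.spanned box" .
qed

subsection \<open>The socle functional\<close>

text \<open>The monomials equivalent to the socle \<open>\<Prod>\<^sub>i x\<^sub>i\<^bsup>d\<^sub>i - 1\<^esup>\<close> under the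
  reductions correspond to the sets \<open>S\<close> of cyclically non-adjacent indices: those at which the
  reduction has been applied backwards.\<close>

definition socle_exponent :: "nat set \<Rightarrow> nat \<Rightarrow> nat" where
  "socle_exponent S i =
    (if i \<in> S then 2 * d i - 1 - of_bool (pr (pr i) \<in> S)
     else if pr i \<in> S then 0 else d i - 1 - of_bool (pr (pr i) \<in> S))"

text \<open>A backward reduction at \<open>i\<close> adds \<open>d i\<close> to the exponent at
  \<open>i\<close> and subtracts \<open>d (sg i) - 1\<close> at \<open>sg i\<close> and 1 at
  \<open>sg (sg i)\<close>. Carrying this out on the socle for all elements of a non-adjacent
  \<open>S\<close> gives \<open>socle_exponent S\<close>.\<close>

definition admissible :: "nat set \<Rightarrow> monomial \<Rightarrow> bool" where
  "admissible S \<alpha> \<longleftrightarrow> S \<subseteq> {1..n} \<and> (\<forall>i\<in>S. pr i \<notin> S) \<and> Poly_Mapping.keys \<alpha> \<subseteq> {1..n} \<and>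
     (\<forall>i\<in>{1..n}. Poly_Mapping.lookup \<alpha> i = socle_exponent S i)"

definition large :: "monomial \<Rightarrow> nat set" where
  "large \<alpha> = {i \<in> {1..n}. d i \<le> Poly_Mapping.lookup \<alpha> i}"

text \<open>The product of the factors collected on the way from \<alpha> down to the socle; it is 1
  on the socle itself, where \<open>large \<alpha>\<close> is empty.\<close>

definition weight :: "monomial \<Rightarrow> complex" where
  "weight \<alpha> = (if admissible (large \<alpha>) \<alpha> then \<Prod>i\<in>large \<alpha>. - of_nat (d (sg i)) else 0)"

text \<open>The set \<open>S\<close> can be read off from \<alpha>: exponents at its elements are at
  least \<open>2 * d i - 2\<close>, hence at least \<open>d i\<close>, and all others are at most
  \<open>d i - 1\<close>.\<close>

lemma admissible_large:
  assumes "admissible S \<alpha>"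
  shows "large \<alpha> = S"
proof (intro equalityI subsetI)
  fix i assume "i \<in> large \<alpha>"
  then have "i \<in> {1..n}" "d i \<le> socle_exponent S i"
    using assms by (auto simp: large_def admissible_def)
  with d_ge_2[of i] show "i \<in> S" by (auto simp: socle_exponent_def split: if_splits)
next
  fix i assume "i \<in> S"
  moreover from this have "i \<in> {1..n}" using assms by (auto simp: admissible_def)
  ultimately show "i \<in> large \<alpha>"
    using assms d_ge_2[of i] by (auto simp: large_def admissible_def socle_exponent_def)
qed

lemma weight_admissible: "admissible S \<alpha> \<Longrightarrow> weight \<alpha> = (\<Prod>i\<in>S. - of_nat (d (sg i)))"
  using admissible_large by (simp add: weight_def)

lemma weight_nonzero: "weight \<alpha> \<noteq> 0 \<Longrightarrow> admissible (large \<alpha>) \<alpha>"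
  by (auto simp: weight_def split: if_splits)

text \<open>Oddness excludes \<open>n = 2\<close>, where \<open>sg (sg i)\<close> would return to
  \<open>i\<close>.\<close>

lemma sg_distinct:
  assumes "n \<noteq> 1" "i \<in> {1..n}"
  shows "sg i \<noteq> i" "sg (sg i) \<noteq> i" "sg (sg i) \<noteq> sg i"
proof -
  have "n \<noteq> 2" using odd_n by auto
  with assms show "sg i \<noteq> i" "sg (sg i) \<noteq> i" "sg (sg i) \<noteq> sg i"
    by (auto simp: sg_def)
qed

text \<open>Divisibility by \<open>x_j ^ d j\<close> puts \<open>j\<close> into
  \<open>large\<close>, which is \<open>S\<close>. The reduction then alters only the exponents at
  \<open>j\<close>, \<open>sg j\<close> and \<open>sg (sg j)\<close>, in just the way in which
  \<open>socle_exponent\<close> changes when \<open>j\<close> leaves \<open>S\<close>.\<close>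

lemma admissible_down:
  assumes j: "j \<in> {1..n}" and adm: "admissible S (\<gamma> + Poly_Mapping.single j (d j))"
  shows "j \<in> S" "admissible (S - {j}) (\<gamma> + reduct j)"
proof -
  let ?\<alpha> = "\<gamma> + Poly_Mapping.single j (d j)" and ?\<beta> = "\<gamma> + reduct j"
  have "j \<in> large ?\<alpha>" using j by (simp add: large_def lookup_add)
  then show jS: "j \<in> S" using admissible_large[OF adm] by simp
  have S: "S \<subseteq> {1..n}" "\<And>i. i \<in> S \<Longrightarrow> pr i \<notin> S" "Poly_Mapping.keys \<gamma> \<subseteq> {1..n}"
    using adm by (auto simp: admissible_def keys_add_monomial)
  have "Poly_Mapping.lookup ?\<alpha> i = Poly_Mapping.lookup \<gamma> i + (if i = j then d j else 0)" for i
    by (auto simp: lookup_add lookup_single when_def)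
  then have S4: "Poly_Mapping.lookup \<gamma> i + (if i = j then d j else 0) = socle_exponent S i"
    if "i \<in> {1..n}" for i
    using adm that unfolding admissible_def by metis
  have "n \<noteq> 1" using S(2)[OF jS] jS j by (auto simp: pr_def)
  note dist = sg_distinct[OF this j]
  have sj: "sg j \<in> {1..n}" "sg (sg j) \<in> {1..n}" using j sg_mem by blast+
  have prs: "pr (sg j) = j" "pr (sg (sg j)) = sg j" using pr_sg j sj by blast+
  have nS: "pr j \<notin> S" "sg j \<notin> S" using S(2)[OF jS] S(2)[of "sg j"] jS prs by auto
  have d: "d j \<ge> 2" "d (sg j) \<ge> 2" "d (sg (sg j)) \<ge> 2" using d_ge_2 j sj by blast+
  have "Poly_Mapping.lookup ?\<beta> i = socle_exponent (S - {j}) i" if i: "i \<in> {1..n}" for i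
  proof -
    have inj: "pr i = j \<longleftrightarrow> i = sg j" "pr (pr i) = j \<longleftrightarrow> i = sg (sg j)"
      using sg_pr[OF i] sg_pr[OF pr_mem[OF i]] prs by auto
    have l: "Poly_Mapping.lookup ?\<beta> i = Poly_Mapping.lookup \<gamma> i +
        (if i = sg j then d (sg j) - 1 else 0) + (if i = sg (sg j) then 1 else 0)"
      by (auto simp: reduct_def lookup_add lookup_single when_def)
    consider "i = j" | "i = sg j" | "i = sg (sg j)" | "i \<noteq> j" "i \<noteq> sg j" "i \<noteq> sg (sg j)" by blast
    then show ?thesis
      using S4[OF i] dist nS jS d inj prs unfolding l
      by cases (auto simp: socle_exponent_def split: if_splits)
  qed
  then show "admissible (S - {j}) ?\<beta>"
    using S(1-3) keys_reduct[OF j] by (auto simp: admissible_def keys_add_monomial)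
qed

text \<open>The converse of the downward step. Divisibility by the reduct makes the exponents at
  \<open>sg j\<close> and \<open>sg (sg j)\<close> so large that \<open>pr j\<close>,
  \<open>j\<close> and \<open>sg j\<close> are all outside \<open>S\<close>, and \<open>j\<close>
  can be inserted without creating neighbours.\<close>

lemma admissible_up:
  assumes j: "j \<in> {1..n}" and adm: "admissible S (\<gamma> + reduct j)"
  shows "j \<notin> S" "admissible (insert j S) (\<gamma> + Poly_Mapping.single j (d j))"
proof -
  let ?\<alpha> = "\<gamma> + Poly_Mapping.single j (d j)" and ?\<beta> = "\<gamma> + reduct j"
  have sj: "sg j \<in> {1..n}" "sg (sg j) \<in> {1..n}" using j sg_mem by blast+
  have prs: "pr (sg j) = j" "pr (sg (sg j)) = sg j" using pr_sg j sj by blast+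
  have d: "d j \<ge> 2" "d (sg j) \<ge> 2" "d (sg (sg j)) \<ge> 2" using d_ge_2 j sj by blast+
  have S: "S \<subseteq> {1..n}" "\<And>i. i \<in> S \<Longrightarrow> pr i \<notin> S" "Poly_Mapping.keys \<gamma> \<subseteq> {1..n}"
    using adm by (auto simp: admissible_def keys_add_monomial)
  have "Poly_Mapping.lookup ?\<beta> i = Poly_Mapping.lookup \<gamma> i +
      (if i = sg j then d (sg j) - 1 else 0) + (if i = sg (sg j) then 1 else 0)" for i
    by (auto simp: reduct_def lookup_add lookup_single when_def)
  then have S4: "Poly_Mapping.lookup \<gamma> i + (if i = sg j then d (sg j) - 1 else 0) +
      (if i = sg (sg j) then 1 else 0) = socle_exponent S i"
    if "i \<in> {1..n}" for i
    using adm that unfolding admissible_def by metis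
  have e: "socle_exponent S (sg j) \<ge> d (sg j) - 1" "socle_exponent S (sg (sg j)) \<ge> 1"
    using S4[OF sj(1)] S4[OF sj(2)] by (auto split: if_splits)
  show jS: "j \<notin> S"
  proof
    assume "j \<in> S"
    moreover from this have "sg j \<notin> S" using S(2)[of "sg j"] prs by auto
    ultimately show False using e(1) d prs by (simp add: socle_exponent_def)
  qed
  have nS: "sg j \<notin> S"
  proof
    assume "sg j \<in> S"
    moreover from this have "sg (sg j) \<notin> S" using S(2)[of "sg (sg j)"] prs by auto
    ultimately show False using e(2) prs by (simp add: socle_exponent_def)
  qed
  \<comment> \<open>With \<open>pr j\<close> in \<open>S\<close> the exponent at \<open>sg j\<close>
    would be only \<open>d (sg j) - 2\<close>.\<close>
  have pS: "pr j \<notin> S" using e(1) nS jS prs d by (auto simp: socle_exponent_def)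
  \<comment> \<open>For \<open>n = 1\<close> the reduct is \<open>x_1 ^ d 1\<close>, which exceeds
    the exponent \<open>d 1 - 1\<close> of the socle.\<close>
  have "n \<noteq> 1"
  proof
    assume "n = 1"
    have "sg j = j" "pr j = j" unfolding sg_def pr_def using j \<open>n = 1\<close> by auto
    with S4[OF j] jS d show False by (auto simp: socle_exponent_def)
  qed
  note dist = sg_distinct[OF this j]
  have "Poly_Mapping.lookup ?\<alpha> i = socle_exponent (insert j S) i" if i: "i \<in> {1..n}" for i
  proof -
    have inj: "pr i = j \<longleftrightarrow> i = sg j" "pr (pr i) = j \<longleftrightarrow> i = sg (sg j)"
      using sg_pr[OF i] sg_pr[OF pr_mem[OF i]] prs by auto
    have l: "Poly_Mapping.lookup ?\<alpha> i = Poly_Mapping.lookup \<gamma> i + (if i = j then d j else 0)"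
      by (auto simp: lookup_add lookup_single when_def)
    consider "i = j" | "i = sg j" | "i = sg (sg j)" | "i \<noteq> j" "i \<noteq> sg j" "i \<noteq> sg (sg j)" by blast
    then show ?thesis
      using S4[OF i] dist nS jS pS d inj prs unfolding l
      by cases (auto simp: socle_exponent_def split: if_splits)
  qed
  moreover have "\<forall>i\<in>insert j S. pr i \<notin> insert j S"
  proof -
    have "pr i \<noteq> j" if "i \<in> S" for i
      using that nS sg_pr[of i] S(1) by auto
    moreover have "pr j \<noteq> j" using dist(1) sg_pr[OF j] by metis
    ultimately show ?thesis using S(2) pS by auto
  qed
  ultimately show "admissible (insert j S) ?\<alpha>"
    using S(1,3) j by (auto simp: admissible_def keys_add_monomial split: if_splits)
qed

text \<open>The weight is compatible with every reduction: by the downward and upward steps the two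
  monomials are admissible together, and their sets differ exactly by \<open>j\<close>, whose factor
  is \<open>- d (sg j)\<close>.\<close>

lemma weight_reduct:
  assumes j: "j \<in> {1..n}"
  shows "weight (\<gamma> + Poly_Mapping.single j (d j)) = - of_nat (d (sg j)) * weight (\<gamma> + reduct j)"
proof (cases "\<exists>S. admissible S (\<gamma> + Poly_Mapping.single j (d j))")
  case True
  then obtain S where S: "admissible S (\<gamma> + Poly_Mapping.single j (d j))" by blast
  have "finite S" using S finite_subset[of S "{1..n}"] by (auto simp: admissible_def)
  from prod.remove[OF this admissible_down(1)[OF j S], of "\<lambda>i. - of_nat (d (sg i)) :: complex"]
  show ?thesis
    by (simp add: weight_admissible[OF S] weight_admissible[OF admissible_down(2)[OF j S]])
next
  case False
  then have "weight (\<gamma> + Poly_Mapping.single j (d j)) = 0" "weight (\<gamma> + reduct j) = 0"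
    using weight_nonzero admissible_up(2)[OF j] by blast+
  then show ?thesis by simp
qed

definition weight_support :: "monomial \<Rightarrow> monomial set" where
  "weight_support \<gamma> = {\<beta>. weight (\<beta> + \<gamma>) \<noteq> 0}"

text \<open>Exponents of admissible monomials stay below \<open>2 * d i\<close>. Finite support is
  what allows the functional to be applied to power series.\<close>

lemma finite_weight_nonzero: "finite {\<alpha>. weight \<alpha> \<noteq> 0}"
proof (rule finite_subset)
  show "finite big_box" unfolding big_box_def by (rule finite_bounded_monomials) simp
  show "{\<alpha>. weight \<alpha> \<noteq> 0} \<subseteq> big_box"
  proof
    fix \<alpha> assume "\<alpha> \<in> {\<alpha>. weight \<alpha> \<noteq> 0}"
    then have "admissible (large \<alpha>) \<alpha>" using weight_nonzero by simp
    moreover have "socle_exponent S i < 2 * d i" if "i \<in> {1..n}" for S i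
      using d_ge_2[OF that] by (auto simp: socle_exponent_def)
    ultimately show "\<alpha> \<in> big_box" by (auto simp: admissible_def big_box_def)
  qed
qed

lemma finite_weight_support: "finite (weight_support \<gamma>)"
proof -
  have "weight_support \<gamma> = (\<lambda>\<beta>. \<beta> + \<gamma>) -` {\<alpha>. weight \<alpha> \<noteq> 0}" by (auto simp: weight_support_def)
  then show ?thesis using finite_vimageI[OF finite_weight_nonzero, of "\<lambda>\<beta>. \<beta> + \<gamma>"] by (simp add: inj_on_def)
qed

text \<open>The weight functional evaluated at the product of the monomial \<gamma> with
  \<open>h\<close>. The shift is carried along because the series annihilated for all shifts form an
  ideal.\<close>

definition pairing :: "monomial \<Rightarrow> series \<Rightarrow> complex" where
  "pairing \<gamma> h = (\<Sum>\<beta>\<in>weight_support \<gamma>. weight (\<beta> + \<gamma>) * h \<beta>)"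

lemma pairing_add: "pairing \<gamma> (\<lambda>\<alpha>. g \<alpha> + h \<alpha>) = pairing \<gamma> g + pairing \<gamma> h"
  by (simp add: pairing_def distrib_left sum.distrib)

lemma pairing_scale: "pairing \<gamma> (\<lambda>\<alpha>. c * h \<alpha>) = c * pairing \<gamma> h"
  by (simp add: pairing_def sum_distrib_left mult.left_commute)

lemma pairing_monom: "pairing \<gamma> (monom_series 1 \<beta>) = weight (\<beta> + \<gamma>)"
  by (simp add: pairing_def monom_series_def if_distrib sum.delta[OF finite_weight_support] cong: if_cong)
     (simp add: weight_support_def)

text \<open>Expanding only the first factor writes the pairing with a product as a finite
  combination of shifted pairings with the second factor, so a series killed by all shifts keeps
  this property under multiplication.\<close>

lemma pairing_mult:
  "pairing \<gamma> (series_mult g h) =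
     (\<Sum>\<delta>\<in>fst ` {(\<delta>, \<epsilon>). weight (\<delta> + \<epsilon> + \<gamma>) \<noteq> 0}. g \<delta> * pairing (\<gamma> + \<delta>) h)"
proof -
  let ?S = "\<lambda>\<alpha>::monomial. {(\<delta>, \<epsilon>). \<delta> + \<epsilon> = \<alpha>}"
  let ?Q = "{(\<delta>, \<epsilon>). weight (\<delta> + \<epsilon> + \<gamma>) \<noteq> 0}"
  have Q: "?Q = (\<Union>\<beta>\<in>weight_support \<gamma>. ?S \<beta>)" by (auto simp: weight_support_def)
  have fin: "finite ?Q" unfolding Q using finite_weight_support finite_splits by blast
  \<comment> \<open>The same pairs, now grouped by the first factor instead of by the
    product.\<close>
  have Q': "?Q = Sigma (fst ` ?Q) (\<lambda>\<delta>. weight_support (\<gamma> + \<delta>))"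
    by (auto simp: weight_support_def add_ac image_iff)
  have "pairing \<gamma> (series_mult g h) =
      (\<Sum>\<beta>\<in>weight_support \<gamma>. \<Sum>p\<in>?S \<beta>. weight (fst p + snd p + \<gamma>) * (g (fst p) * h (snd p)))"
    unfolding pairing_def series_mult_def sum_distrib_left
    by (intro sum.cong) auto
  also have "\<dots> = (\<Sum>p\<in>?Q. weight (fst p + snd p + \<gamma>) * (g (fst p) * h (snd p)))"
    unfolding Q by (rule sum.UNION_disjoint[symmetric]) (auto simp: finite_weight_support finite_splits)
  also have "\<dots> = (\<Sum>(\<delta>, \<epsilon>)\<in>Sigma (fst ` ?Q) (\<lambda>\<delta>. weight_support (\<gamma> + \<delta>)).
      weight (\<delta> + \<epsilon> + \<gamma>) * (g \<delta> * h \<epsilon>))"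
    unfolding Q'[symmetric] by (simp add: case_prod_unfold)
  also have "\<dots> = (\<Sum>\<delta>\<in>fst ` ?Q. \<Sum>\<epsilon>\<in>weight_support (\<gamma> + \<delta>). weight (\<delta> + \<epsilon> + \<gamma>) * (g \<delta> * h \<epsilon>))"
    by (rule sum.Sigma[symmetric]) (auto intro: finite_imageI fin finite_weight_support)
  also have "\<dots> = (\<Sum>\<delta>\<in>fst ` ?Q. g \<delta> * pairing (\<gamma> + \<delta>) h)"
    by (simp add: pairing_def sum_distrib_left ac_simps)
  finally show ?thesis .
qed

text \<open>The series killed by all shifted pairings form an ideal \<open>K\<close>. It contains
  the partial derivatives by \<open>weight_reduct\<close>, applied at the predecessor index, and the
  Jacobian ideal is the least such ideal.\<close>

lemma pairing_ideal:
  assumes "h \<in> J"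
  shows "pairing \<gamma> h = 0"
proof -
  let ?R = "convergent_series n"
  interpret cring ?R by (rule cring_convergent_series)
  define K where "K = {h \<in> carrier ?R. \<forall>\<gamma>. pairing \<gamma> h = 0}"
  have mult: "series_mult g h \<in> K" if "h \<in> K" "g \<in> carrier ?R" for g h
    using that by (simp add: K_def series_mult_carrier pairing_mult)
  have "ideal K ?R"
  proof (rule idealI)
    show "subgroup K (add_monoid ?R)"
    proof (rule add.subgroupI)
      show "\<ominus>\<^bsub>?R\<^esub> h \<in> K" if "h \<in> K" for h
      proof -
        have h: "h \<in> carrier ?R" using that by (simp add: K_def)
        have "\<ominus>\<^bsub>?R\<^esub> h = (\<lambda>\<alpha>. -1 * h \<alpha>)"
          by (rule minus_equality) (use h series_scale_carrier[OF h, of "-1"] in auto)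
        then show ?thesis
          using that series_scale_carrier[OF h, of "-1"] pairing_scale[of _ "-1" h] by (simp add: K_def)
      qed
      show "K \<noteq> {}"
        using zero_closed by (auto simp: K_def pairing_def)
    qed (auto simp: K_def pairing_add series_add_carrier)
  next
    fix h g assume "h \<in> K" "g \<in> carrier ?R"
    then show "g \<otimes>\<^bsub>?R\<^esub> h \<in> K" "h \<otimes>\<^bsub>?R\<^esub> g \<in> K"
      using mult series_mult_commute[of h g] by simp_all
  qed (rule ring_axioms)
  moreover have "(\<lambda>i. partial_series i f) ` {1..n} \<subseteq> K"
  proof
    fix h assume "h \<in> (\<lambda>i. partial_series i f) ` {1..n}"
    then obtain i where i: "i \<in> {1..n}" "h = partial_series i f" by blast
    have "pairing \<gamma> h = 0" for \<gamma>
      using weight_reduct[OF pr_mem[OF i(1)], of \<gamma>] sg_pr[OF i(1)]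
      by (simp add: i(2) partial_f[OF i(1)] pairing_add pairing_scale pairing_monom reduct_def add_ac)
    then show "h \<in> K" using i partial_f_carrier by (simp add: K_def)
  qed
  ultimately have "J \<subseteq> K" unfolding jacobian_ideal_def by (rule genideal_minimal)
  with assms show ?thesis by (auto simp: K_def)
qed

text \<open>As \<open>n\<close> is odd, \<open>i \<mapsto> i - 2\<close> is transitive on the cycle of indices.\<close>

lemma independent_set_empty:
  assumes S: "S \<subseteq> {1..n}" "\<And>i. i \<in> S \<Longrightarrow> pr i \<notin> S" "\<And>i. i \<in> S \<Longrightarrow> pr (pr i) \<in> S"
  shows "S = {}"
proof (rule ccontr)
  assume "S \<noteq> {}"
  then obtain i where i: "i \<in> S" by blast
  \<comment> \<open>The condition \<open>2 * k < i\<close> keeps the descent from wrapping around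
    the cycle.\<close>
  have descend: "2 * k < i \<Longrightarrow> i - 2 * k \<in> S" if "i \<in> S" for i k
  proof (induction k)
    case (Suc k)
    then have "pr (pr (i - 2 * k)) \<in> S" using S(3) by simp
    then show ?case using Suc.prems by (simp add: pr_def split: if_splits)
  qed (use that in simp)
  have even_odd: "1 \<in> S \<or> 2 \<in> S"
  proof (cases "even i")
    case True
    then obtain b where "i = 2 * b" by blast
    moreover from this obtain c where "b = Suc c" using i S(1) by (cases b) auto
    ultimately show ?thesis using descend[OF i, of c] by simp
  next
    case False
    then obtain b where "i = 2 * b + 1" by (rule oddE)
    then show ?thesis using descend[OF i, of b] by simp
  qed
  have n3: "n \<ge> 3"
  proof -
    have "n \<noteq> 1"
    proof
      assume "n = 1"
      moreover from this have "i = 1" using i S(1) by auto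
      ultimately have "pr i = i" unfolding pr_def by simp
      with S(2)[OF i] i show False by simp
    qed
    with odd_n show ?thesis by (cases "n = 0 \<or> n = 2") auto
  qed
  \<comment> \<open>Only from 1 and 2 do two predecessor steps wrap around, and they change the
    parity because \<open>n\<close> is odd.\<close>
  have 1: "1 \<in> S \<Longrightarrow> n - 1 \<in> S" and 2: "2 \<in> S \<Longrightarrow> n \<in> S"
    using S(3)[of 1] S(3)[of 2] n3 by (auto simp: pr_def numeral_2_eq_2)
  \<comment> \<open>The descent from the even index \<open>n - 1\<close> ends at 2 and the one from
    the odd index \<open>n\<close> ends at 1, so the neighbours 1 and 2 would both lie in
    \<open>S\<close>.\<close>
  have "2 \<in> S" if "1 \<in> S"
    using descend[OF 1[OF that], of "(n - 3) div 2"] odd_n n3 by (auto elim!: oddE)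
  moreover have "1 \<in> S" if "2 \<in> S"
    using descend[OF 2[OF that], of "(n - 1) div 2"] odd_n n3 by (auto elim!: oddE)
  ultimately show False using even_odd S(2)[of 2] by (auto simp: pr_def)
qed

section \<open>Duality in the box and linear independence\<close>

definition socle :: monomial where
  "socle = (\<Sum>i\<in>{1..n}. Poly_Mapping.single i (d i - 1))"

lemma lookup_socle: "Poly_Mapping.lookup socle i = (if i \<in> {1..n} then d i - 1 else 0)"
  by (simp add: socle_def lookup_sum lookup_single when_def)

text \<open>For \<open>a = b\<close> the monomial is the socle. If the weight is nonzero with index
  set \<open>S\<close>, then at \<open>i \<in> S\<close> the exponent is at most
  \<open>2 * d i - 2\<close>, as \<open>b\<close> lies in the box; this forces
  \<open>pr (pr i) \<in> S\<close>. Hence \<open>S\<close> is empty, the monomial is the socle, and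
  \<open>a = b\<close>.\<close>

lemma weight_dual:
  assumes a: "a \<in> box" and b: "b \<in> box"
  shows "weight (b + (socle - a)) = (if a = b then 1 else 0)"
proof -
  have l: "Poly_Mapping.lookup (b + (socle - a)) i + Poly_Mapping.lookup a i =
      Poly_Mapping.lookup b i + (d i - 1)" if "i \<in> {1..n}" for i
  proof -
    have "Poly_Mapping.lookup a i < d i" using that a by (simp add: box_def)
    then show ?thesis using that by (simp add: lookup_add lookup_minus lookup_socle)
  qed
  have k: "Poly_Mapping.keys (b + (socle - a)) \<subseteq> {1..n}"
    using b by (auto simp: in_keys_iff lookup_add lookup_minus lookup_socle box_def subset_iff split: if_splits)
  show ?thesis
  proof (cases "a = b")
    case True
    have "Poly_Mapping.lookup (b + (socle - a)) i = socle_exponent {} i" if "i \<in> {1..n}" for i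
      using l[OF that] True by (simp add: socle_exponent_def)
    then have "admissible {} (b + (socle - a))"
      using k by (simp add: admissible_def)
    then show ?thesis using True by (simp add: weight_admissible)
  next
    case False
    have "weight (b + (socle - a)) = 0"
    proof (rule ccontr)
      define S where "S = large (b + (socle - a))"
      assume "weight (b + (socle - a)) \<noteq> 0"
      then have adm: "admissible S (b + (socle - a))" unfolding S_def by (rule weight_nonzero)
      have e: "socle_exponent S i + Poly_Mapping.lookup a i = Poly_Mapping.lookup b i + (d i - 1)"
        if "i \<in> {1..n}" for i
        using l[OF that] adm that by (simp add: admissible_def)
      have "S = {}"
      proof (rule independent_set_empty)
        show "pr i \<notin> S" if "i \<in> S" for i using adm that by (auto simp: admissible_def)
        show "pr (pr i) \<in> S" if "i \<in> S" for i
        proof (rule ccontr)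
          assume "pr (pr i) \<notin> S"
          moreover have i: "i \<in> {1..n}" using that adm by (auto simp: admissible_def)
          moreover have "Poly_Mapping.lookup b i < d i" using i b by (simp add: box_def)
          ultimately show False using e[OF i] that by (simp add: socle_exponent_def)
        qed
      qed (use adm in \<open>auto simp: admissible_def\<close>)
      have "a = b"
      proof (rule poly_mapping_eqI)
        fix i show "Poly_Mapping.lookup a i = Poly_Mapping.lookup b i"
        proof (cases "i \<in> {1..n}")
          case True
          then show ?thesis using e[OF True] \<open>S = {}\<close> by (simp add: socle_exponent_def)
        next
          case False
          then have "i \<notin> Poly_Mapping.keys a" "i \<notin> Poly_Mapping.keys b" using a b by (auto simp: box_def)
          then show ?thesis by (simp add: in_keys_iff)
        qed
      qed
      with False show False by simp
    qed
    with False show ?thesis by simp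
  qed
qed

text \<open>Pairing with the complement of \<open>a\<close> in the socle extracts the coefficient of
  \<open>p\<close> at \<open>a\<close>, and every pairing vanishes on the ideal.\<close>

lemma box_independent:
  assumes p: "p \<in> J" "\<And>\<alpha>. p \<alpha> \<noteq> 0 \<Longrightarrow> \<alpha> \<in> box"
  shows "p = (\<lambda>\<alpha>. 0)"
proof
  fix a
  show "p a = 0"
  proof (cases "a \<in> box")
    case True
    have "pairing (socle - a) p = (\<Sum>\<beta>\<in>weight_support (socle - a). if \<beta> = a then p a else 0)"
      unfolding pairing_def
    proof (rule sum.cong)
      fix \<beta>
      show "weight (\<beta> + (socle - a)) * p \<beta> = (if \<beta> = a then p a else 0)"
        using weight_dual[OF True, of \<beta>] p(2)[of \<beta>] by (cases "p \<beta> = 0") auto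
    qed simp
    also have "\<dots> = p a"
      using weight_dual[OF True True]
      by (subst sum.delta[OF finite_weight_support]) (simp add: weight_support_def)
    finally show ?thesis using pairing_ideal[OF p(1)] by simp
  qed (use p(2) in blast)
qed

theorem milnor_number_loop_poly: "milnor_number n f = enat (\<Prod>i\<in>{1..n}. d i)"
proof -
  have "milnor_number n f = enat (card box)"
  proof (rule milnor_number_eqI)
    show "finite box" unfolding box_def by (rule finite_bounded_monomials) simp
    show "Poly_Mapping.keys \<alpha> \<subseteq> {1..n}" if "\<alpha> \<in> box" for \<alpha> using that by (simp add: box_def)
    show "0 \<in> box" using d_ge_2 by (force simp: box_def)
    show "series_ideal n J" by (rule J.series_ideal_axioms)
    show "carrier (convergent_series n) \<subseteq> J.spanned box" by (rule series_spanned)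
    show "p = (\<lambda>\<alpha>. 0)" if "p \<in> J" "\<And>\<alpha>. p \<alpha> \<noteq> 0 \<Longrightarrow> \<alpha> \<in> box" for p
      using that by (rule box_independent)
  qed
  then show ?thesis by (simp add: box_def card_bounded_monomials)
qed

end

subsection \<open>Critical points\<close>

definition monomial_eval :: "(nat \<Rightarrow> complex) \<Rightarrow> monomial \<Rightarrow> complex" where
  "monomial_eval x \<alpha> = (\<Prod>i\<in>Poly_Mapping.keys \<alpha>. x i ^ Poly_Mapping.lookup \<alpha> i)"

lemma monomial_eval_superset:
  assumes "finite A" "Poly_Mapping.keys \<alpha> \<subseteq> A"
  shows "monomial_eval x \<alpha> = (\<Prod>i\<in>A. x i ^ Poly_Mapping.lookup \<alpha> i)"
  unfolding monomial_eval_def using assms by (intro prod.mono_neutral_left) (auto simp: in_keys_iff)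

lemma monomial_eval_add: "monomial_eval x (\<alpha> + \<beta>) = monomial_eval x \<alpha> * monomial_eval x \<beta>"
proof -
  let ?A = "Poly_Mapping.keys \<alpha> \<union> Poly_Mapping.keys \<beta>"
  have "monomial_eval x (\<alpha> + \<beta>) = (\<Prod>i\<in>?A. x i ^ Poly_Mapping.lookup (\<alpha> + \<beta>) i)"
    by (rule monomial_eval_superset) (auto simp: keys_add_monomial)
  then show ?thesis
    by (simp add: lookup_add power_add prod.distrib monomial_eval_superset[of ?A])
qed

lemma monomial_eval_single: "monomial_eval x (Poly_Mapping.single i k) = x i ^ k"
  by (simp add: monomial_eval_def)

lemma poly_eval_superset:
  assumes "finite A" "Poly_Mapping.keys p \<subseteq> A"
  shows "poly_eval p x = (\<Sum>\<alpha>\<in>A. Poly_Mapping.lookup p \<alpha> * monomial_eval x \<alpha>)"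
  unfolding poly_eval_def monomial_eval_def
  using assms by (intro sum.mono_neutral_left) (auto simp: in_keys_iff)

lemma poly_eval_add: "poly_eval (p + q) x = poly_eval p x + poly_eval q x"
proof -
  let ?A = "Poly_Mapping.keys p \<union> Poly_Mapping.keys q"
  have "poly_eval (p + q) x = (\<Sum>\<alpha>\<in>?A. Poly_Mapping.lookup (p + q) \<alpha> * monomial_eval x \<alpha>)"
    using keys_add[of p q] by (intro poly_eval_superset) auto
  then show ?thesis
    by (simp add: lookup_add distrib_right sum.distrib poly_eval_superset[of ?A])
qed

lemma poly_eval_sum: "poly_eval (\<Sum>i\<in>A. p i) x = (\<Sum>i\<in>A. poly_eval (p i) x)"
proof (induction A rule: infinite_finite_induct)
  case (insert i A)
  then show ?case by (simp add: poly_eval_add)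
qed (simp_all add: poly_eval_def)

lemma poly_eval_single: "poly_eval (Poly_Mapping.single \<alpha> c) x = c * monomial_eval x \<alpha>"
  by (simp add: poly_eval_def monomial_eval_def)

context loop
begin

lemma poly_eval_loop_poly: "poly_eval (loop_poly n d) x = (\<Sum>i\<in>{1..n}. x i ^ d i * x (sg i))"
  by (simp add: loop_poly_eq poly_eval_sum poly_eval_single cycle_monomial_def monomial_eval_add
      monomial_eval_single)

text \<open>As for the formal derivative, the contributions of the terms \<open>i\<close> and
  \<open>pr i\<close> are added, which covers \<open>n = 1\<close>, where these terms
  coincide.\<close>

lemma deriv_loop_poly:
  assumes i: "i \<in> {1..n}"
  shows "deriv (\<lambda>t. poly_eval (loop_poly n d) (x(i := t))) (x i) =
    of_nat (d i) * x i ^ (d i - 1) * x (sg i) + x (pr i) ^ d (pr i)"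
proof -
  have coord: "((\<lambda>t. (x(i := t)) j) has_field_derivative of_bool (j = i)) (at (x i))" for j
    by (cases "j = i") auto
  have "((\<lambda>t. (x(i := t)) j ^ d j * (x(i := t)) (sg j)) has_field_derivative
      (if j = i then of_nat (d i) * x i ^ (d i - 1) * x (sg i) else 0) +
      (if j = pr i then x (pr i) ^ d (pr i) else 0)) (at (x i))" if j: "j \<in> {1..n}" for j
  proof -
    have "sg j = i \<longleftrightarrow> j = pr i" using pr_sg[OF j] sg_pr[OF i] by auto
    then show ?thesis
      by (intro DERIV_cong[OF DERIV_mult[OF DERIV_power[OF coord] coord]]) (simp add: fun_upd_triv)
  qed
  from DERIV_sum[of "{1..n}", OF this]
  have "((\<lambda>t. poly_eval (loop_poly n d) (x(i := t))) has_field_derivative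
      (\<Sum>j\<in>{1..n}. (if j = i then of_nat (d i) * x i ^ (d i - 1) * x (sg i) else 0) +
      (if j = pr i then x (pr i) ^ d (pr i) else 0))) (at (x i))"
    unfolding poly_eval_loop_poly .
  then have "deriv (\<lambda>t. poly_eval (loop_poly n d) (x(i := t))) (x i) =
      (\<Sum>j\<in>{1..n}. (if j = i then of_nat (d i) * x i ^ (d i - 1) * x (sg i) else 0) +
      (if j = pr i then x (pr i) ^ d (pr i) else 0))"
    by (rule DERIV_imp_deriv)
  also have "\<dots> = of_nat (d i) * x i ^ (d i - 1) * x (sg i) + x (pr i) ^ d (pr i)"
    using i pr_mem[OF i] by (simp add: sum.distrib)
  finally show ?thesis .
qed

text \<open>The i-th equation times \<open>x_i\<close> relates the values of two consecutive terms
  of the polynomial: the modulus of the term \<open>pr i\<close> is \<open>d i\<close> times that of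
  the term \<open>i\<close>. A term of maximal modulus must then vanish, so all terms do, and the
  equations leave only pure powers.\<close>

lemma critical_point_iff: "critical_point n (loop_poly n d) x \<longleftrightarrow> x = origin n"
proof
  assume "x = origin n"
  then have x: "x \<in> complex_space n" "\<And>i. i \<in> {1..n} \<Longrightarrow> x i = 0"
    by (auto simp: origin_def complex_space_def)
  have "deriv (\<lambda>t. poly_eval (loop_poly n d) (x(i := t))) (x i) = 0" if i: "i \<in> {1..n}" for i
    unfolding deriv_loop_poly[OF i]
    using x(2)[OF sg_mem[OF i]] x(2)[OF pr_mem[OF i]] d_ge_2[OF pr_mem[OF i]] by simp
  with x(1) show "critical_point n (loop_poly n d) x"
    unfolding critical_point_def by blast
next
  assume crit: "critical_point n (loop_poly n d) x"
  have eq: "of_nat (d i) * x i ^ (d i - 1) * x (sg i) + x (pr i) ^ d (pr i) = 0" if "i \<in> {1..n}" for i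
    using crit that unfolding critical_point_def deriv_loop_poly[OF that, symmetric] by blast
  define m where "m i = x i ^ d i * x (sg i)" for i
  have m: "of_nat (d i) * m i + m (pr i) = 0" if i: "i \<in> {1..n}" for i
  proof -
    have "x i ^ d i = x i ^ (d i - 1) * x i" using d_ge_2[OF i] by (cases "d i") auto
    then have "of_nat (d i) * m i + m (pr i) =
        (of_nat (d i) * x i ^ (d i - 1) * x (sg i) + x (pr i) ^ d (pr i)) * x i"
      by (simp add: m_def sg_pr[OF i] algebra_simps)
    then show ?thesis using eq[OF i] by simp
  qed
  have norm_m: "2 * norm (m i) \<le> norm (m (pr i))" if i: "i \<in> {1..n}" for i
  proof -
    have "m (pr i) = - (of_nat (d i) * m i)" using m[OF i] by (simp add: add_eq_0_iff)
    then have "norm (m (pr i)) = real (d i) * norm (m i)" by (simp add: norm_mult)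
    moreover have "real 2 \<le> real (d i)" using d_ge_2[OF i] by (rule of_nat_mono)
    ultimately show ?thesis using mult_right_mono[of 2 "real (d i)" "norm (m i)"] by simp
  qed
  have "finite ((\<lambda>i. norm (m i)) ` {1..n})" "(\<lambda>i. norm (m i)) ` {1..n} \<noteq> {}" using n_pos by auto
  from Max_in[OF this] obtain i where i: "i \<in> {1..n}"
      and max: "norm (m i) = Max ((\<lambda>i. norm (m i)) ` {1..n})" by auto
  have le: "norm (m j) \<le> norm (m i)" if "j \<in> {1..n}" for j
    unfolding max using that by (intro Max_ge) auto
  have "norm (m i) = 0" using norm_m[OF i] le[OF pr_mem[OF i]] norm_ge_zero[of "m i"] by linarith
  then have m0: "m j = 0" if "j \<in> {1..n}" for j using le[OF that] by simp
  have "x i = 0" if i: "i \<in> {1..n}" for i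
  proof -
    let ?j = "sg i"
    have j: "?j \<in> {1..n}" using sg_mem[OF i] .
    \<comment> \<open>The vanishing term stays zero when one factor \<open>x ?j\<close> is dropped,
      because \<open>d ?j - 1\<close> is still positive.\<close>
    have "x ?j ^ (d ?j - 1) * x (sg ?j) = 0"
      using m0[OF j] d_ge_2[OF j] by (auto simp: m_def)
    then have "of_nat (d ?j) * x ?j ^ (d ?j - 1) * x (sg ?j) = 0"
      by (simp only: mult.assoc mult_zero_right)
    with eq[OF j] have "x (pr ?j) ^ d (pr ?j) = 0" by (simp only: add_0)
    then show ?thesis using pr_sg[OF i] by simp
  qed
  with crit show "x = origin n"
    by (auto simp: critical_point_def complex_space_def origin_def fun_eq_iff PiE_def extensional_def)
qed

text \<open>Any radius serves, since the origin is the only critical point in the whole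
  space.\<close>

lemma isolated_critical_origin_loop_poly: "isolated_critical_origin n (loop_poly n d)"
  unfolding isolated_critical_origin_def critical_point_iff by (auto intro: exI[of _ 1])

end

subsection \<open>Orbits of the action\<close>

lemma scaling_Bij:
  assumes "\<And>i. i \<in> {1..n} \<Longrightarrow> c i \<noteq> 0"
  shows "(\<lambda>x\<in>complex_space n. \<lambda>i\<in>{1..n}. c i * x i) \<in> Bij (complex_space n)"
proof -
  have "bij_betw (\<lambda>x\<in>complex_space n. \<lambda>i\<in>{1..n}. c i * x i) (complex_space n) (complex_space n)"
    by (rule bij_betwI[where g = "\<lambda>x. \<lambda>i\<in>{1..n}. inverse (c i) * x i"])
       (use assms in \<open>auto simp: complex_space_def fun_eq_iff PiE_def extensional_def mult.assoc[symmetric]\<close>)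
  then show ?thesis by (simp add: Bij_def)
qed

locale loop_action_data = loop +
  fixes g :: int and \<epsilon> :: complex
  assumes data: "loop_data n d g \<epsilon>"
begin

definition m :: nat where "m = (\<Prod>i\<in>{1..n}. d i) + 1"

text \<open>The factor by which the generator \<open>g\<close> acts on the i-th coordinate.\<close>

definition a :: "nat \<Rightarrow> complex" where
  "a i = \<epsilon> powi ((-1) ^ (i - 1) * (\<Prod>j\<in>{1..<i}. int (d j)))"

lemma m_gt_1: "m > 1"
  using d_ge_2 by (simp add: m_def prod_pos) force

lemma root: "\<epsilon> ^ m = 1" "0 < k \<Longrightarrow> k < m \<Longrightarrow> \<epsilon> ^ k \<noteq> 1"
  using data by (auto simp: loop_data_def primitive_root_of_unity_def m_def)

lemma eps_nonzero: "\<epsilon> \<noteq> 0"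
  using root(1) m_gt_1 by (auto simp: power_0_left)

lemma powi_eq_1_iff: "\<epsilon> powi z = 1 \<longleftrightarrow> int m dvd z"
proof -
  have "\<epsilon> powi z = \<epsilon> powi (int m * (z div int m) + z mod int m)" by simp
  also have "\<dots> = (\<epsilon> powi int m) powi (z div int m) * \<epsilon> powi (z mod int m)"
    using eps_nonzero by (simp only: power_int_add power_int_mult simp_thms)
  also have "\<dots> = \<epsilon> ^ nat (z mod int m)"
    using root(1) m_gt_1 by (simp add: power_int_def)
  finally have *: "\<epsilon> powi z = \<epsilon> ^ nat (z mod int m)" .
  show ?thesis
  proof
    assume "\<epsilon> powi z = 1"
    moreover have "nat (z mod int m) < m" using m_gt_1 by (simp add: nat_less_iff)
    ultimately have "nat (z mod int m) = 0" using root(2) * by (metis not_gr0)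
    then have "z mod int m \<le> 0" by simp
    moreover have "0 \<le> z mod int m" using m_gt_1 by simp
    ultimately have "z mod int m = 0" by (rule order_antisym)
    then show "int m dvd z" by (simp add: dvd_eq_mod_eq_0)
  qed (simp add: * dvd_eq_mod_eq_0)
qed

text \<open>Up to sign the exponent of \<open>a i\<close> divides \<open>m - 1\<close>, so it is
  coprime to \<open>m\<close> and does not affect divisibility by \<open>m\<close>.\<close>

lemma a_power_eq_1_iff:
  assumes i: "i \<in> {1..n}"
  shows "a i ^ k = 1 \<longleftrightarrow> m dvd k"
proof -
  let ?P = "\<Prod>j\<in>{1..<i}. d j"
  have "?P dvd m - 1" unfolding m_def using i by (simp add: prod_dvd_prod_subset subset_iff)
  moreover have "coprime (m - 1) m" by (simp add: m_def coprime_Suc_right_nat)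
  ultimately have cop: "coprime m ?P" by (metis coprime_divisors coprime_commute dvd_refl)
  have "a i ^ k = \<epsilon> powi ((-1) ^ (i - 1) * (\<Prod>j\<in>{1..<i}. int (d j)) * int k)"
    by (simp add: a_def power_int_power')
  then have "a i ^ k = 1 \<longleftrightarrow> int m dvd (-1) ^ (i - 1) * (int ?P * int k)"
    by (simp add: powi_eq_1_iff mult.assoc)
  also have "\<dots> \<longleftrightarrow> int m dvd int ?P * int k"
    by (cases "even (i - 1)") (auto simp: minus_one_power_iff)
  also have "\<dots> \<longleftrightarrow> m dvd ?P * k" by (simp only: of_nat_mult[symmetric] int_dvd_int_iff)
  also have "\<dots> \<longleftrightarrow> m dvd k" using cop by (simp add: coprime_dvd_mult_right_iff)
  finally show ?thesis .
qed

lemma a_nonzero: "a i \<noteq> 0"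
  using eps_nonzero by (simp add: a_def)

lemma a_power_cong:
  assumes i: "i \<in> {1..n}" and kl: "k mod m = l mod m"
  shows "a i ^ k = a i ^ l"
proof -
  have "a i ^ k = a i ^ (k mod m)" for k
  proof -
    have "a i ^ k = a i ^ (m * (k div m) + k mod m)" by simp
    also have "\<dots> = a i ^ (k mod m)"
      using a_power_eq_1_iff[OF i, of m] by (simp only: power_add power_mult) simp
    finally show ?thesis .
  qed
  from this[of k] this[of l] kl show ?thesis by simp
qed

lemma a_power_inj:
  assumes i: "i \<in> {1..n}"
  shows "inj_on (\<lambda>k. a i ^ k) {..<m}"
proof (rule linorder_inj_onI)
  fix k l assume "k < l" and kl: "k \<in> {..<m}" "l \<in> {..<m}"
  show "a i ^ k \<noteq> a i ^ l"
  proof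
    assume "a i ^ k = a i ^ l"
    moreover have "a i ^ l = a i ^ k * a i ^ (l - k)" using \<open>k < l\<close> by (simp flip: power_add)
    ultimately have "a i ^ (l - k) = 1" using a_nonzero[of i] by simp
    then have "m dvd l - k" using a_power_eq_1_iff[OF i] by blast
    with \<open>k < l\<close> kl show False by (auto dest: dvd_imp_le)
  qed
qed auto

text \<open>This is the invariance of a single term. For \<open>i < n\<close> the exponents of
  \<epsilon> cancel by the alternating signs; for \<open>i = n\<close> oddness makes the sign
  positive and the exponents add up to \<open>m\<close>.\<close>

lemma a_loop:
  assumes i: "i \<in> {1..n}"
  shows "a i ^ d i * a (sg i) = 1"
proof -
  let ?P = "\<lambda>i. \<Prod>j\<in>{1..<i}. int (d j)"
  have P: "?P (Suc i) = ?P i * int (d i)" using i by (simp add: prod.atLeastLessThan_Suc)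
  have "a i ^ d i = \<epsilon> powi ((-1) ^ (i - 1) * ?P (Suc i))"
    by (simp only: P) (simp add: a_def power_int_power' mult.assoc)
  then have *: "a i ^ d i * a (sg i) =
      \<epsilon> powi ((-1) ^ (i - 1) * ?P (Suc i) + (-1) ^ (sg i - 1) * ?P (sg i))"
    using eps_nonzero by (simp add: a_def power_int_add)
  show ?thesis
  proof (cases "i = n")
    case True
    have "(-1) ^ (i - 1) * ?P (Suc i) + (-1) ^ (sg i - 1) * ?P (sg i) = int m"
      using odd_n True by (simp add: sg_def m_def atLeastLessThanSuc_atLeastAtMost)
    then show ?thesis using * root(1) by simp
  next
    case False
    have "(-1 :: int) ^ i = - ((-1) ^ (i - 1))" using i by (cases i) auto
    then have "(-1) ^ (i - 1) * ?P (Suc i) + (-1) ^ (sg i - 1) * ?P (sg i) = 0"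
      using False by (simp add: sg_def)
    then show ?thesis using * by simp
  qed
qed

abbreviation G :: "int monoid" where "G \<equiv> loop_group n d"

lemma G_eq: "G = integer_mod_group m"
  by (simp add: loop_group_def m_def)

lemma group_G: "group G"
  by (simp add: G_eq)

lemma carrier_G: "carrier G = {0..<int m}"
  using m_gt_1 by (simp add: G_eq carrier_integer_mod_group)

lemma g_mem: "g \<in> carrier G"
  using data by (simp add: loop_data_def)

text \<open>In a finite group natural exponents suffice, so statements about the action reduce to
  induction on the exponent.\<close>

lemma carrier_G_powers: "carrier G = {g [^]\<^bsub>G\<^esub> k | k. k \<in> (UNIV :: nat set)}"
proof -
  have "finite (carrier G)" by (simp add: carrier_G)
  from group.generate_pow_on_finite_carrier[OF group_G this g_mem] data
  show ?thesis by (simp add: loop_data_def)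
qed

text \<open>The generator \<open>g\<close> may differ from the residue 1, so the action is defined
  through a multiplier \<open>u\<close> that inverts \<open>g\<close> modulo
  \<open>m\<close>.\<close>

lemma loop_action_exists: "\<exists>\<tau>. loop_action n d g \<epsilon> \<tau>"
proof -
  have "1 \<in> carrier G" using m_gt_1 by (simp add: carrier_G)
  then obtain u :: nat where "1 = g [^]\<^bsub>G\<^esub> u" using carrier_G_powers by auto
  then have u: "(int u * g) mod int m = 1" by (simp add: G_eq)
  \<comment> \<open>Modulo \<open>m\<close> the residue \<open>h\<close> is \<open>u * h\<close>
    times \<open>g\<close>, so it has to act as the \<open>u * h\<close>-th power of the
    generator.\<close>
  define \<tau> where "\<tau> h = (\<lambda>x\<in>complex_space n. \<lambda>i\<in>{1..n}. a i ^ (u * nat h) * x i)" for h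
  have Bij: "\<tau> h \<in> Bij (complex_space n)" for h
    unfolding \<tau>_def by (rule scaling_Bij) (simp add: a_nonzero)
  have "\<tau> (h \<otimes>\<^bsub>G\<^esub> k) = compose (complex_space n) (\<tau> h) (\<tau> k)"
    if h: "h \<in> carrier G" and k: "k \<in> carrier G" for h k
  proof -
    have "nat ((h + k) mod int m) = (nat h + nat k) mod m"
      using h k by (simp add: carrier_G nat_mod_distrib nat_add_distrib)
    then have "u * nat ((h + k) mod int m) mod m = (u * nat h + u * nat k) mod m"
      by (simp only: mod_mult_right_eq distrib_left[symmetric])
    then have "a i ^ (u * nat ((h + k) mod int m)) = a i ^ (u * nat h) * a i ^ (u * nat k)"
      if "i \<in> {1..n}" for i
      using a_power_cong[OF that] unfolding power_add[symmetric] by blast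
    then show ?thesis
      by (auto simp: \<tau>_def compose_def G_eq complex_space_def fun_eq_iff mult.assoc)
  qed
  then have "\<tau> \<in> hom G (BijGroup (complex_space n))"
    by (auto simp: hom_def BijGroup_def Bij)
  then have "group_action G (complex_space n) \<tau>"
    by (intro group_action.intro group_hom.intro group_hom_axioms.intro group_G group_BijGroup)
  moreover have "\<tau> g x = (\<lambda>i\<in>{1..n}. a i * x i)" if x: "x \<in> complex_space n" for x
  proof -
    have "0 \<le> g" using g_mem by (simp add: carrier_G)
    then have "int (u * nat g mod m) = int u * g mod int m"
      by (simp only: zmod_int of_nat_mult nat_0_le)
    also have "\<dots> = int (1 mod m)" using u m_gt_1 by simp
    finally have "u * nat g mod m = 1 mod m" by (simp only: of_nat_eq_iff)
    then have "a i ^ (u * nat g) = a i" if "i \<in> {1..n}" for i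
      using a_power_cong[OF that, of "u * nat g" 1] by simp
    then show ?thesis using x by (auto simp: \<tau>_def)
  qed
  ultimately show ?thesis unfolding loop_action_def a_def by blast
qed

section \<open>Orbit lengths and invariance for a given action\<close>

context
  fixes \<tau> assumes \<tau>: "loop_action n d g \<epsilon> \<tau>"
begin

interpretation action: group_action G "complex_space n" \<tau>
  using \<tau> by (simp add: loop_action_def)

lemma action_power:
  assumes x: "x \<in> complex_space n"
  shows "\<tau> (g [^]\<^bsub>G\<^esub> (k::nat)) x = (\<lambda>i\<in>{1..n}. a i ^ k * x i)"
  using x
proof (induction k arbitrary: x)
  case 0
  then have "\<tau> \<one>\<^bsub>G\<^esub> x = x" using fun_cong[OF action.id_eq_one, of x] by simp
  with 0 show ?case
    by (auto simp: complex_space_def fun_eq_iff PiE_def extensional_def G_eq)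
next
  case (Suc k)
  interpret group G by (rule group_G)
  have 1: "\<tau> g x = (\<lambda>i\<in>{1..n}. a i * x i)" using \<tau> Suc.prems by (simp add: loop_action_def a_def)
  have 2: "(\<lambda>i\<in>{1..n}. a i * x i) \<in> complex_space n" by (simp add: complex_space_def)
  have 3: "\<tau> (g [^]\<^bsub>G\<^esub> Suc k) x = \<tau> (g [^]\<^bsub>G\<^esub> k) (\<tau> g x)"
    unfolding nat_pow_Suc using action.composition_rule[OF Suc.prems nat_pow_closed[OF g_mem] g_mem] .
  show ?case unfolding 3 1 Suc.IH[OF 2] by (auto simp: fun_eq_iff)
qed

lemma orbit_eq:
  assumes x: "x \<in> complex_space n"
  shows "orbit G \<tau> x = (\<lambda>k. \<lambda>i\<in>{1..n}. a i ^ k * x i) ` {..<m}"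
proof (intro equalityI subsetI)
  fix y assume "y \<in> orbit G \<tau> x"
  then obtain k :: nat where "y = \<tau> (g [^]\<^bsub>G\<^esub> k) x"
    unfolding orbit_def carrier_G_powers by blast
  then have "y = (\<lambda>i\<in>{1..n}. a i ^ k * x i)" by (simp add: action_power[OF x])
  also have "\<dots> = (\<lambda>i\<in>{1..n}. a i ^ (k mod m) * x i)"
    by (rule restrict_ext) (use a_power_cong[of _ k "k mod m"] in simp)
  finally show "y \<in> (\<lambda>k. \<lambda>i\<in>{1..n}. a i ^ k * x i) ` {..<m}"
    by (rule image_eqI) (use m_gt_1 in simp)
next
  fix y assume "y \<in> (\<lambda>k. \<lambda>i\<in>{1..n}. a i ^ k * x i) ` {..<m}"
  then obtain k where "y = \<tau> (g [^]\<^bsub>G\<^esub> (k::nat)) x" by (auto simp: action_power[OF x])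
  then show "y \<in> orbit G \<tau> x" unfolding orbit_def carrier_G_powers by blast
qed

text \<open>One nonzero coordinate \<open>x i\<close> already separates the points of the orbit,
  because the powers of \<open>a i\<close> with exponents below \<open>m\<close> are
  distinct.\<close>

lemma card_orbit:
  assumes x: "x \<in> complex_space n" and nz: "x \<noteq> origin n"
  shows "card (orbit G \<tau> x) = m"
proof -
  have "\<exists>i\<in>{1..n}. x i \<noteq> 0"
  proof (rule ccontr)
    assume "\<not> (\<exists>i\<in>{1..n}. x i \<noteq> 0)"
    then have "x i = origin n i" for i
      using x by (cases "i \<in> {1..n}") (auto simp: complex_space_def origin_def PiE_def extensional_def)
    with nz show False by blast
  qed
  then obtain i where i: "i \<in> {1..n}" "x i \<noteq> 0" by blast
  have "inj_on (\<lambda>k. \<lambda>i\<in>{1..n}. a i ^ k * x i) {..<m}"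
  proof (rule inj_onI)
    fix k l assume kl: "k \<in> {..<m}" "l \<in> {..<m}"
      and eq: "(\<lambda>i\<in>{1..n}. a i ^ k * x i) = (\<lambda>i\<in>{1..n}. a i ^ l * x i)"
    from fun_cong[OF eq, of i] i have "a i ^ k = a i ^ l" by simp
    then show "k = l" using a_power_inj[OF i(1)] kl by (auto dest: inj_onD)
  qed
  then show ?thesis by (simp add: orbit_eq[OF x] card_image)
qed

lemma origin_mem: "origin n \<in> complex_space n"
  by (simp add: origin_def complex_space_def)

lemma orbit_origin: "orbit G \<tau> (origin n) = {origin n}"
proof -
  have "(\<lambda>i\<in>{1..n}. a i ^ k * origin n i) = origin n" for k by (auto simp: origin_def)
  then show ?thesis
    unfolding orbit_eq[OF origin_mem] using m_gt_1 by (auto simp: image_constant_conv)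
qed

lemma card_nonzero_orbit:
  assumes "Y \<in> orbits G (complex_space n) \<tau>" "Y \<noteq> {origin n}"
  shows "card Y = m"
  using assms card_orbit orbit_origin by (auto simp: orbits_def)

lemma shortest_orbit_length_eq: "shortest_orbit_length G (complex_space n) \<tau> = m"
  unfolding shortest_orbit_length_def
proof (rule Least_equality)
  have one: "(\<lambda>i\<in>{1..n}. 1) \<in> complex_space n" by (simp add: complex_space_def)
  have "(1::nat) \<in> {1..n}" using n_pos by simp
  \<comment> \<open>The point with all coordinates 1 is moved by \<open>g\<close>, so the minimum is
    taken over a nonempty set of lengths.\<close>
  moreover from this have "a 1 \<noteq> 1" using a_power_eq_1_iff[of 1 1] m_gt_1 by simp
  ultimately have "\<tau> (g [^]\<^bsub>G\<^esub> (1::nat)) (\<lambda>i\<in>{1..n}. 1) \<noteq> (\<lambda>i\<in>{1..n}. 1)"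
    unfolding action_power[OF one] by (auto simp: fun_eq_iff)
  moreover have "g [^]\<^bsub>G\<^esub> (1::nat) \<in> carrier G" unfolding carrier_G_powers by blast
  moreover have "(\<lambda>i\<in>{1..n}. 1) \<noteq> origin n"
  proof
    assume "(\<lambda>i\<in>{1..n}. 1) = origin n"
    from fun_cong[OF this, of 1] n_pos show False by (simp add: origin_def)
  qed
  ultimately show "\<exists>x\<in>complex_space n. (\<exists>h\<in>carrier G. \<tau> h x \<noteq> x) \<and> m = card (orbit G \<tau> x)"
    using one card_orbit by metis
next
  fix k assume "\<exists>x\<in>complex_space n. (\<exists>h\<in>carrier G. \<tau> h x \<noteq> x) \<and> k = card (orbit G \<tau> x)"
  then obtain x h where x: "x \<in> complex_space n" "h \<in> carrier G" "\<tau> h x \<noteq> x" "k = card (orbit G \<tau> x)"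
    by blast
  have "x \<noteq> origin n"
  proof
    assume "x = origin n"
    moreover have "\<tau> h x \<in> orbit G \<tau> x" using x(2) by (auto simp: orbit_def)
    ultimately show False using x(3) orbit_origin by simp
  qed
  then show "m \<le> k" using card_orbit x by simp
qed

text \<open>The k-th power of the generator multiplies the i-th term by the k-th power of
  \<open>a i ^ d i * a (sg i)\<close>, which is 1.\<close>

lemma invariant_loop_poly: "invariant_polynomial G n \<tau> (loop_poly n d)"
  unfolding invariant_polynomial_def
proof (intro ballI)
  fix h x assume "h \<in> carrier G" and x: "x \<in> complex_space n"
  then obtain k :: nat where k: "h = g [^]\<^bsub>G\<^esub> k" using carrier_G_powers by blast
  have "(a i ^ k * x i) ^ d i * (a (sg i) ^ k * x (sg i)) = x i ^ d i * x (sg i)"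
    if i: "i \<in> {1..n}" for i
  proof -
    have "(a i ^ k * x i) ^ d i * (a (sg i) ^ k * x (sg i)) =
        (a i ^ d i * a (sg i)) ^ k * (x i ^ d i * x (sg i))"
      by (simp add: power_mult_distrib power_commutes flip: power_mult) (simp add: mult_ac)
    then show ?thesis using a_loop[OF i] by simp
  qed
  then show "poly_eval (loop_poly n d) (\<tau> h x) = poly_eval (loop_poly n d) x"
    unfolding poly_eval_loop_poly k action_power[OF x]
    using sg_mem by (intro sum.cong) auto
qed

end

end

section \<open>Existence of the data in every odd dimension and the conclusions\<close>

lemma loop_data_imp_locale:
  assumes "loop_data n d g \<epsilon>"
  shows "loop_action_data n d g \<epsilon>"
  using assms by unfold_locales (auto simp: loop_data_def)

lemma primitive_root_of_unity_exp:
  assumes "m \<ge> 1"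
  shows "primitive_root_of_unity m (exp (2 * of_real pi * \<i> * of_nat 1 / of_nat m))"
proof -
  let ?\<epsilon> = "exp (2 * of_real pi * \<i> * of_nat 1 / of_nat m) :: complex"
  have "?\<epsilon> ^ k = exp (2 * of_real pi * \<i> * of_nat k / of_nat m)" for k
    by (simp flip: exp_of_nat_mult add: field_simps)
  then have "?\<epsilon> ^ k = 1 \<longleftrightarrow> m dvd k" for k
    using complex_root_unity_eq_1[OF assms] by metis
  then show ?thesis
    unfolding primitive_root_of_unity_def by (metis dvd_refl nat_dvd_not_less)
qed

text \<open>The simplest instance, with all exponents 2 and the residue 1 as generator; it makes the
  claim about arbitrarily large dimension non-vacuous.\<close>

lemma loop_data_two:
  assumes "odd n"
  shows "\<exists>\<epsilon>. loop_data n (\<lambda>_. 2) 1 \<epsilon>"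
proof -
  let ?m = "(\<Prod>i\<in>{1..n}. 2) + 1 :: nat"
  have m: "?m > 1" by simp
  have "primitive_root_of_unity ?m (exp (2 * of_real pi * \<i> * of_nat 1 / of_nat ?m))"
    by (rule primitive_root_of_unity_exp) simp
  moreover have "1 \<in> carrier (integer_mod_group ?m)" using m by (simp add: carrier_integer_mod_group)
  moreover from this have "generate (integer_mod_group ?m) {1} = carrier (integer_mod_group ?m)"
  proof (intro equalityI subsetI)
    fix h assume "h \<in> carrier (integer_mod_group ?m)"
    then have "h = 1 [^]\<^bsub>integer_mod_group ?m\<^esub> h"
      by (simp add: carrier_integer_mod_group int_pow_integer_mod_group)
    then show "h \<in> generate (integer_mod_group ?m) {1}"
      using group.generate_pow[OF group_integer_mod_group \<open>1 \<in> _\<close>] by blast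
  qed (use group.generate_incl[OF group_integer_mod_group, of "{1}" ?m] \<open>1 \<in> _\<close> in auto)
  ultimately show ?thesis using assms by (auto simp: loop_data_def loop_group_def)
qed

lemma loop_data_conclusions:
  assumes "loop_data n d g \<epsilon>" "loop_action n d g \<epsilon> \<tau>"
  shows "invariant_polynomial (loop_group n d) n \<tau> (loop_poly n d)"
    and "isolated_critical_origin n (loop_poly n d)"
    and "milnor_number n (Poly_Mapping.lookup (loop_poly n d)) = enat (\<Prod>i\<in>{1..n}. d i)"
    and "\<And>Y. Y \<in> orbits (loop_group n d) (complex_space n) \<tau> \<Longrightarrow> Y \<noteq> {origin n} \<Longrightarrow>
           card Y = (\<Prod>i\<in>{1..n}. d i) + 1"
    and "milnor_number n (Poly_Mapping.lookup (loop_poly n d)) =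
           enat (shortest_orbit_length (loop_group n d) (complex_space n) \<tau> - 1)"
proof -
  interpret loop_action_data n d g \<epsilon> using assms(1) by (rule loop_data_imp_locale)
  show "invariant_polynomial (loop_group n d) n \<tau> (loop_poly n d)"
    using assms(2) by (rule invariant_loop_poly)
  show "isolated_critical_origin n (loop_poly n d)" by (rule isolated_critical_origin_loop_poly)
  show *: "milnor_number n (Poly_Mapping.lookup (loop_poly n d)) = enat (\<Prod>i\<in>{1..n}. d i)"
    by (rule milnor_number_loop_poly)
  show "card Y = (\<Prod>i\<in>{1..n}. d i) + 1"
    if "Y \<in> orbits (loop_group n d) (complex_space n) \<tau>" "Y \<noteq> {origin n}" for Y
    using card_nonzero_orbit[OF assms(2) that] by (simp add: m_def)
  show "milnor_number n (Poly_Mapping.lookup (loop_poly n d)) =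
      enat (shortest_orbit_length (loop_group n d) (complex_space n) \<tau> - 1)"
    using * shortest_orbit_length_eq[OF assms(2)] by (simp add: m_def)
qed

theorem mainTheorem2:
  shows "(\<forall>(n::nat) (d::nat \<Rightarrow> nat) (g::int) (\<epsilon>::complex). loop_data n d g \<epsilon> \<longrightarrow>
            (\<exists>\<tau>. loop_action n d g \<epsilon> \<tau>) \<and>
            (\<forall>\<tau>. loop_action n d g \<epsilon> \<tau> \<longrightarrow>
               invariant_polynomial (loop_group n d) n \<tau> (loop_poly n d) \<and>
               isolated_critical_origin n (loop_poly n d) \<and>
               milnor_number n (Poly_Mapping.lookup (loop_poly n d)) = enat (\<Prod>i\<in>{1..n}. d i) \<and>
               (\<forall>Y\<in>orbits (loop_group n d) (complex_space n) \<tau>.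
                  Y \<noteq> {origin n} \<longrightarrow> card Y = (\<Prod>i\<in>{1..n}. d i) + 1) \<and>
               milnor_number n (Poly_Mapping.lookup (loop_poly n d)) =
                 enat (shortest_orbit_length (loop_group n d) (complex_space n) \<tau> - 1)))
       \<and>
         (\<forall>N::nat. \<exists>n\<ge>N. \<exists>(d::nat \<Rightarrow> nat) (g::int) (\<epsilon>::complex) \<tau>.
            loop_data n d g \<epsilon> \<and> loop_action n d g \<epsilon> \<tau> \<and>
            milnor_number n (Poly_Mapping.lookup (loop_poly n d)) =
              enat (shortest_orbit_length (loop_group n d) (complex_space n) \<tau> - 1))"
proof (intro conjI allI impI ballI)
  show "\<exists>\<tau>. loop_action n d g \<epsilon> \<tau>" if "loop_data n d g \<epsilon>" for n d g \<epsilon>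
    using loop_action_data.loop_action_exists[OF loop_data_imp_locale[OF that]] .
next
  fix N :: nat
  \<comment> \<open>An odd dimension that is not below \<open>N\<close>.\<close>
  have "odd (2 * N + 1)" by simp
  then obtain \<epsilon> where \<epsilon>: "loop_data (2 * N + 1) (\<lambda>_. 2) 1 \<epsilon>" using loop_data_two by blast
  moreover obtain \<tau> where "loop_action (2 * N + 1) (\<lambda>_. 2) 1 \<epsilon> \<tau>"
    using loop_action_data.loop_action_exists[OF loop_data_imp_locale[OF \<epsilon>]] by blast
  moreover have "2 * N + 1 \<ge> N" by simp
  ultimately show "\<exists>n\<ge>N. \<exists>(d::nat \<Rightarrow> nat) (g::int) (\<epsilon>::complex) \<tau>.
      loop_data n d g \<epsilon> \<and> loop_action n d g \<epsilon> \<tau> \<and>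
      milnor_number n (Poly_Mapping.lookup (loop_poly n d)) =
        enat (shortest_orbit_length (loop_group n d) (complex_space n) \<tau> - 1)"
    using loop_data_conclusions(5) by blast
next
  fix n :: nat and d :: "nat \<Rightarrow> nat" and g :: int and \<epsilon> :: complex and \<tau>
  assume "loop_data n d g \<epsilon>" "loop_action n d g \<epsilon> \<tau>"
  note concl = loop_data_conclusions[OF this]
  show "invariant_polynomial (loop_group n d) n \<tau> (loop_poly n d)" by (rule concl(1))
  show "isolated_critical_origin n (loop_poly n d)" by (rule concl(2))
  show "milnor_number n (Poly_Mapping.lookup (loop_poly n d)) = enat (\<Prod>i\<in>{1..n}. d i)" by (rule concl(3))
  show "card Y = (\<Prod>i\<in>{1..n}. d i) + 1"
    if "Y \<in> orbits (loop_group n d) (complex_space n) \<tau>" "Y \<noteq> {origin n}" for Y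
    using that by (rule concl(4))
  show "milnor_number n (Poly_Mapping.lookup (loop_poly n d)) =
      enat (shortest_orbit_length (loop_group n d) (complex_space n) \<tau> - 1)" by (rule concl(5))
qed

end
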